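(* Suppose that $1\leq n<\omega$, $\vec{x} = \langle x_\alpha \mid \alpha<\omega_n\rangle$ is an ascending sequence of sets, $H$ is a nonzero abelian group with $|H|\leq 2^{\omega_1}$, and $\mathrm{w}\diamondsuit(S^{k+1}_k)$ holds for all $k<n$. Then there is a nontrivial coherent $n$-family $\Phi = \langle \varphi_b : \bigcap_{i<n}x_{b(i)}\to H \mid b\in(\omega_n)^n\rangle$. Moreover, if $\vec{e} = \langle e_w \mid w\in\mathrm{Fn}^+(\omega_n)\rangle$ and $C\subseteq\omega_n$ witness that $\vec{x}$ is ascending, then $\Phi$ can be chosen to be supported on $\vec{e}$.
   Context: Notation: $u =^* v$ for functions means they agree at all but finitely many points of their common domain; $u\subseteq^* v$ means $u\setminus v$ is finite. Sums of functions are taken on the intersection of their domains. Elements of $\delta^n$ are functions $u:n\to\delta$; $u^i$ is the sequence of length $n-1$ obtained by deleting $u(i)$. For a nonempty set $Y$, $\mathrm{Fn}^+(Y)$ is the set of finite partial functions $w$ from $Y$ to $2$ with $w^{-1}\{1\}\neq\emptyset$. Let $\delta$ be a limit ordinal of uncountable cofinality and $\vec{x}=\langle x_\alpha\mid\alpha<\delta\rangle$ sets. $\vec{x}$ respects $w\in\mathrm{Fn}^+(\delta)$ if $d_w:=\bigcap_{\beta\in w^{-1}\{1\}}x_\beta\setminus\bigcup_{\alpha\in w^{-1}\{0\}}x_\alpha$ is infinite. $\vec{x}$ is ascending if there are $\langle e_w\mid w\in\mathrm{Fn}^+(\delta)\rangle$ and a club $C\subseteq\delta$ (said to witness ascendingness)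 with: (a) $e_w$ is a countably infinite subset of $d_w$ if $\vec{x}$ respects $w$, and $e_w=\emptyset$ otherwise; (b) for $\beta\in C$ and finite $a\subseteq\beta$, $x_\beta\not\subseteq^*\bigcup_{\alpha\in a}x_\alpha$; (c) for finite $a\subseteq C$ and $w\in\mathrm{Fn}^+(\min a)$ respected by $\vec{x}$, $e_w\cap\bigcap_{\beta\in a}x_\beta$ is infinite. An $n$-family indexed along $\vec{x}$ is $\Phi=\langle\varphi_a:\bigcap_{i<n}x_{a(i)}\to H\mid a\in\delta^n\rangle$. It is alternating if $\varphi_{a\circ\sigma}=\mathrm{sgn}(\sigma)\varphi_a$ for every permutation $\sigma$ of $n$; coherent if alternating and $\sum_{i<n+1}(-1)^i\varphi_{v^i}=^*0$ for all $v\in\delta^{n+1}$; trivial if ($n=1$) there is $\psi:\bigcup_\alpha x_\alpha\to H$ with $\psi\restriction x_\alpha=^*\varphi_\alpha$ for all $\alpha$, or ($n>1$) there is an alternating $(n-1)$-family $\langle\psi_t\mid t\in\delta^{n-1}\rangle$ with $\varphi_u=^*\sum_{i<n}(-1)^i\psi_{u^i}$ for all $u\in\delta^n$. $\Phi$ is supported on $\vec{e}$ if for all $a\in\delta^n$, $\mathrm{supp}(\varphi_a)\subseteq\bigcup\{e_w\mid w\in\mathrm{Fn}^+(\max_i a(i))\}$. $S^{k+1}_k=\{\alpha<\omega_{k+1}\mid\mathrm{cf}(\alpha)=\omega_k\}$. For regular uncountable $\lambda$ and stationary $S\subseteq\lambda$, $\mathrm{w}\diamondsuit(S)$: for every $F:{}^{<\lambda}2\to2$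 there is $g:\lambda\to2$ such that for every $b:\lambda\to2$, $\{\alpha\in S\mid g(\alpha)=F(b\restriction\alpha)\}$ is stationary. *)

theory Defs
  imports Main "HOL-Library.Countable_Set" "HOL-Combinatorics.Permutations"
begin

unbundle cardinal_syntax

text \<open>
  Ordinals are modelled inside a type \<open>'o\<close> of class \<open>wellorder\<close>: an element \<open>\<alpha>\<close> is an ordinal,
  identified with the initial segment \<open>{..<\<alpha>}\<close> of its predecessors, and an ordinal \<open>\<delta>\<close> that need
  not be an element of \<open>'o\<close> is given directly as an initial segment \<open>\<delta> :: 'o set\<close>.  The set \<open>2\<close>
  is \<open>bool\<close>, with \<open>True\<close> for \<open>1\<close>.
\<close>

section \<open>The ordinals \<open>\<omega>\<^sub>k\<close>, clubs, weak diamond\<close>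

text \<open>
  \<open>\<omega>\<close> consists of the finite ordinals, and \<open>\<omega>\<^sub>k\<^sub>+\<^sub>1\<close> of the ordinals of cardinality at most \<open>\<aleph>\<^sub>k\<close>.
  If \<open>'o\<close> is too short these sets are cut off at the end of \<open>'o\<close>; \<open>omegas_exist\<close> excludes this
  up to \<open>\<omega>\<^sub>n\<close>.
\<close>

primrec omega :: "nat \<Rightarrow> 'o::wellorder set" where
  "omega 0 = {\<alpha>. finite {..<\<alpha>}}"
| "omega (Suc k) = {\<alpha>. |{..<\<alpha>}| \<le>o |omega k :: 'o set|}"

definition omegas_exist :: "'o::wellorder itself \<Rightarrow> nat \<Rightarrow> bool" where
  "omegas_exist _ n \<longleftrightarrow>
     |omega 0 :: 'o set| =o natLeq \<and>
     (\<forall>k<n. |omega (Suc k) :: 'o set| =o cardSuc |omega k :: 'o set| )"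

definition club :: "'o::wellorder set \<Rightarrow> 'o set \<Rightarrow> bool" where
  "club \<delta> C \<longleftrightarrow>
     C \<subseteq> \<delta> \<and>
     (\<forall>\<xi>\<in>\<delta>. \<exists>\<gamma>\<in>C. \<xi> \<le> \<gamma>) \<and>
     (\<forall>\<alpha>\<in>\<delta>. {..<\<alpha>} \<noteq> {} \<and> (\<forall>\<xi><\<alpha>. \<exists>\<gamma>\<in>C. \<xi> < \<gamma> \<and> \<gamma> < \<alpha>) \<longrightarrow> \<alpha> \<in> C)"

definition stationary :: "'o::wellorder set \<Rightarrow> 'o set \<Rightarrow> bool" where
  "stationary \<delta> S \<longleftrightarrow> S \<subseteq> \<delta> \<and> (\<forall>C. club \<delta> C \<longrightarrow> S \<inter> C \<noteq> {})"

definition cofinal_in :: "'o::wellorder \<Rightarrow> 'o set \<Rightarrow> bool" where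
  "cofinal_in \<alpha> A \<longleftrightarrow> A \<subseteq> {..<\<alpha>} \<and> (\<forall>\<xi><\<alpha>. \<exists>\<eta>\<in>A. \<xi> \<le> \<eta>)"

text \<open>\<open>cf(\<alpha>) = \<kappa>\<close>, for \<open>\<kappa>\<close> a cardinal (initial ordinal): \<open>\<kappa>\<close> is the least size of a cofinal subset.\<close>

definition has_cof :: "'o::wellorder \<Rightarrow> 'o set \<Rightarrow> bool" where
  "has_cof \<alpha> \<kappa> \<longleftrightarrow>
     (\<exists>A. cofinal_in \<alpha> A \<and> |A| =o |\<kappa>| ) \<and> (\<forall>A. cofinal_in \<alpha> A \<longrightarrow> |\<kappa>| \<le>o |A| )"

text \<open>The set \<open>S\<close> with upper index \<open>k + 1\<close> and lower index \<open>k\<close>.\<close>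

definition S_cof :: "nat \<Rightarrow> 'o::wellorder set" where
  "S_cof k = {\<alpha> \<in> omega (Suc k). has_cof \<alpha> (omega k)}"

text \<open>
  An element of \<open>\<^sup>\<alpha>2\<close> is a map with domain exactly \<open>{..<\<alpha>}\<close>, so that \<open>F\<close> sees \<open>\<alpha>\<close> as well as the
  values; only values of \<open>F\<close> at such maps with \<open>\<alpha> \<in> \<kappa>\<close> matter.
\<close>

definition weak_diamond :: "'o::wellorder set \<Rightarrow> 'o set \<Rightarrow> bool" where
  "weak_diamond \<kappa> S \<longleftrightarrow>
     (\<forall>F :: ('o \<rightharpoonup> bool) \<Rightarrow> bool. \<exists>g :: 'o \<Rightarrow> bool. \<forall>b :: 'o \<Rightarrow> bool.
        stationary \<kappa> {\<alpha>\<in>S. g \<alpha> = F ((Some \<circ> b) |` {..<\<alpha>})})"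

section \<open>Ascending sequences\<close>

definition Fn_plus :: "'o set \<Rightarrow> ('o \<rightharpoonup> bool) set" where
  "Fn_plus Y = {w. finite (dom w) \<and> dom w \<subseteq> Y \<and> {\<beta>. w \<beta> = Some True} \<noteq> {}}"

definition cell :: "('o \<Rightarrow> 's set) \<Rightarrow> ('o \<rightharpoonup> bool) \<Rightarrow> 's set" where
  "cell x w = (\<Inter>\<beta>\<in>{\<beta>. w \<beta> = Some True}. x \<beta>) - (\<Union>\<alpha>\<in>{\<alpha>. w \<alpha> = Some False}. x \<alpha>)"

definition seq_respects :: "('o \<Rightarrow> 's set) \<Rightarrow> ('o \<rightharpoonup> bool) \<Rightarrow> bool" where
  "seq_respects x w \<longleftrightarrow> infinite (cell x w)"

definition witnesses_ascending ::
  "'o::wellorder set \<Rightarrow> ('o \<Rightarrow> 's set) \<Rightarrow> (('o \<rightharpoonup> bool) \<Rightarrow> 's set) \<Rightarrow> 'o set \<Rightarrow> bool" where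
  "witnesses_ascending \<delta> x e C \<longleftrightarrow>
     club \<delta> C \<and>
     (\<forall>w\<in>Fn_plus \<delta>.
        if seq_respects x w then e w \<subseteq> cell x w \<and> countable (e w) \<and> infinite (e w) else e w = {}) \<and>
     (\<forall>\<beta>\<in>C. \<forall>a. finite a \<and> a \<subseteq> {..<\<beta>} \<longrightarrow> infinite (x \<beta> - (\<Union>\<alpha>\<in>a. x \<alpha>))) \<and>
     (\<forall>a w. finite a \<and> a \<noteq> {} \<and> a \<subseteq> C \<and> w \<in> Fn_plus {..<Min a} \<and> seq_respects x w \<longrightarrow>
        infinite (e w \<inter> (\<Inter>\<beta>\<in>a. x \<beta>)))"

definition ascending :: "'o::wellorder set \<Rightarrow> ('o \<Rightarrow> 's set) \<Rightarrow> bool" where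
  "ascending \<delta> x \<longleftrightarrow> (\<exists>e C. witnesses_ascending \<delta> x e C)"

section \<open>Families of functions\<close>

text \<open>
  Elements of \<open>\<delta>\<^sup>n\<close> are lists of length \<open>n\<close>.  In an \<open>n\<close>-family \<open>\<phi> :: 'o list \<Rightarrow> 's \<Rightarrow> 'h\<close> the function
  \<open>\<phi> a\<close> has domain \<open>fdom x a\<close>; its values elsewhere are junk and are never inspected below.
\<close>

definition tuples :: "nat \<Rightarrow> 'o set \<Rightarrow> 'o list set" where
  "tuples n \<delta> = {a. length a = n \<and> set a \<subseteq> \<delta>}"

definition fdom :: "('o \<Rightarrow> 's set) \<Rightarrow> 'o list \<Rightarrow> 's set" where
  "fdom x a = (\<Inter>i<length a. x (a ! i))"

definition del_nth :: "nat \<Rightarrow> 'a list \<Rightarrow> 'a list" where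
  "del_nth i u = take i u @ drop (Suc i) u"

definition alt_sum :: "nat \<Rightarrow> (nat \<Rightarrow> 'h::ab_group_add) \<Rightarrow> 'h" where
  "alt_sum m f = (\<Sum>i<m. if even i then f i else - f i)"

text \<open>\<open>permute_list \<sigma> a\<close> is the tuple \<open>a \<circ> \<sigma>\<close>.\<close>

definition alternating ::
  "nat \<Rightarrow> 'o set \<Rightarrow> ('o \<Rightarrow> 's set) \<Rightarrow> ('o list \<Rightarrow> 's \<Rightarrow> 'h::ab_group_add) \<Rightarrow> bool" where
  "alternating n \<delta> x \<phi> \<longleftrightarrow>
     (\<forall>a\<in>tuples n \<delta>. \<forall>\<sigma>. \<sigma> permutes {..<n} \<longrightarrow>
        (\<forall>z\<in>fdom x a. \<phi> (permute_list \<sigma> a) z = (if sign \<sigma> = 1 then \<phi> a z else - \<phi> a z)))"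

definition eq_fin_on :: "'s set \<Rightarrow> ('s \<Rightarrow> 'h) \<Rightarrow> ('s \<Rightarrow> 'h) \<Rightarrow> bool" where
  "eq_fin_on D f g \<longleftrightarrow> finite {z\<in>D. f z \<noteq> g z}"

definition coherent ::
  "nat \<Rightarrow> 'o set \<Rightarrow> ('o \<Rightarrow> 's set) \<Rightarrow> ('o list \<Rightarrow> 's \<Rightarrow> 'h::ab_group_add) \<Rightarrow> bool" where
  "coherent n \<delta> x \<phi> \<longleftrightarrow>
     alternating n \<delta> x \<phi> \<and>
     (\<forall>v\<in>tuples (n + 1) \<delta>.
        eq_fin_on (\<Inter>i<n + 1. fdom x (del_nth i v))
          (\<lambda>z. alt_sum (n + 1) (\<lambda>i. \<phi> (del_nth i v) z)) (\<lambda>z. 0))"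

definition trivial_family ::
  "nat \<Rightarrow> 'o set \<Rightarrow> ('o \<Rightarrow> 's set) \<Rightarrow> ('o list \<Rightarrow> 's \<Rightarrow> 'h::ab_group_add) \<Rightarrow> bool" where
  "trivial_family n \<delta> x \<phi> \<longleftrightarrow>
     (n = 1 \<and> (\<exists>\<psi> :: 's \<Rightarrow> 'h. \<forall>\<alpha>\<in>\<delta>. eq_fin_on (x \<alpha>) \<psi> (\<phi> [\<alpha>]))) \<or>
     (n > 1 \<and> (\<exists>\<psi> :: 'o list \<Rightarrow> 's \<Rightarrow> 'h. alternating (n - 1) \<delta> x \<psi> \<and>
        (\<forall>u\<in>tuples n \<delta>.
           eq_fin_on (fdom x u \<inter> (\<Inter>i<n. fdom x (del_nth i u)))
             (\<phi> u) (\<lambda>z. alt_sum n (\<lambda>i. \<psi> (del_nth i u) z)))))"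

definition supported_on ::
  "nat \<Rightarrow> 'o::wellorder set \<Rightarrow> ('o \<Rightarrow> 's set) \<Rightarrow> (('o \<rightharpoonup> bool) \<Rightarrow> 's set) \<Rightarrow>
   ('o list \<Rightarrow> 's \<Rightarrow> 'h::ab_group_add) \<Rightarrow> bool" where
  "supported_on n \<delta> x e \<phi> \<longleftrightarrow>
     (\<forall>a\<in>tuples n \<delta>. {z\<in>fdom x a. \<phi> a z \<noteq> 0} \<subseteq> (\<Union>w\<in>Fn_plus {..<Max (set a)}. e w))"

end

theory Submission
  imports Defs
begin

text \<open>
  The family is built by recursion along \<open>\<omega>\<^sub>n\<close>.  Given a coherent \<open>n\<close>-family on \<open>\<beta>\<close>, an extension to
  \<open>\<beta> + 1\<close> is, up to sign, a trivialization of its restriction to \<open>x\<^sub>\<beta>\<close>; it exists since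
  \<open>|\<beta>| < \<aleph>\<^sub>n\<close>, and two extensions differ by a coherent \<open>(n-1)\<close>-family along \<open>x\<^sub>\<alpha> \<inter> x\<^sub>\<beta>\<close>
  (\<open>\<alpha> < \<beta>\<close>).  When \<open>\<beta>\<close> has cofinality \<open>\<omega>\<^sub>n\<^sub>-\<^sub>1\<close> and is a limit of the witnessing club, that sequence
  can be reindexed in type \<open>\<omega>\<^sub>n\<^sub>-\<^sub>1\<close> so that it is again ascending, so by induction on \<open>n\<close> there is a
  nontrivial such \<open>(n-1)\<close>-family, hence a pair of extensions of which a given \<open>\<psi>\<close> on \<open>\<beta>\<close> can
  trivialize at most one.  The weak diamond guesses the other one at some \<open>\<beta>\<close>.

  The induction starts at \<open>n = 0\<close> with a function that is almost zero on each of countably many sets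
  but not on their union.  Families are indexed by finite sets, with signs given by the order, until
  the end, because this makes the recursion on the maximal index simple.
\<close>


text \<open>The sets \<open>x \<alpha>\<close> may be arbitrarily large, whereas weak diamond only
  predicts functions from an ordinal to 2. Hence everything new at stage \<beta> is confined to
  \<open>E {..<\<beta>} \<inter> x \<beta>\<close>, a set of size less than omega_n, and a candidate
  trivialization has to be coded only over \<open>E {..<\<beta>}\<close>. The support condition of
  the theorem is thus a device of the proof as well as a conclusion.

  The guessing is self-referential: the sequence \<open>g\<close> of choices between two extensions
  is the very function that weak diamond supplies. The predicted object therefore codes
  \<open>g\<close> together with the trivialization, and it can be decoded at \<beta> because the
  family below \<beta> depends only on \<open>g\<close> below \<beta>.

  Values in the group are coded by subsets of omega_(n-1). For n = 1 the bound on |H| may be too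
  weak for this, which is why families and trivializations carry a set \<open>K\<close> of
  admissible values.\<close>

definition sgn_pow :: "nat \<Rightarrow> 'h::ab_group_add \<Rightarrow> 'h" where
  "sgn_pow k h = (if even k then h else - h)"

lemma sgn_pow_sg: "sgn_pow k (sgn_pow l h) = sgn_pow (k + l) h"
  by (auto simp: sgn_pow_def)

lemma sgn_pow_cong: "even (k + l) \<Longrightarrow> sgn_pow k h = sgn_pow l h"
  by (auto simp: sgn_pow_def)

lemma sgn_pow_zero [simp]: "sgn_pow k 0 = 0" "sgn_pow 0 h = h"
  by (auto simp: sgn_pow_def)

lemma sgn_pow_eq_zero_iff [simp]: "sgn_pow k h = 0 \<longleftrightarrow> h = 0"
  by (auto simp: sgn_pow_def)

lemma sgn_pow_Suc: "sgn_pow (Suc k) h = - sgn_pow k h"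
  by (auto simp: sgn_pow_def)

lemma sgn_pow_add: "sgn_pow k (h + h') = sgn_pow k h + sgn_pow k h'"
  by (auto simp: sgn_pow_def)

lemma sgn_pow_diff: "sgn_pow k (h - h') = sgn_pow k h - sgn_pow k h'"
  by (auto simp: sgn_pow_def)

lemma sgn_pow_sum: "sgn_pow k (sum f A) = (\<Sum>i\<in>A. sgn_pow k (f i))"
  by (auto simp: sgn_pow_def sum_negf)

lemma eq_fin_on_eventually:
  "eq_fin_on D f g \<longleftrightarrow> (\<forall>\<^sub>F z in cofinite. z \<in> D \<longrightarrow> f z = g z)"
  unfolding eq_fin_on_def eventually_cofinite by (simp add: not_imp)

section \<open>Cochains on finite subsets of a linear order\<close>

definition rank_in :: "'o::linorder \<Rightarrow> 'o set \<Rightarrow> nat" where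
  "rank_in y a = card {z\<in>a. z < y}"

definition coboundary :: "('o::linorder set \<Rightarrow> 's \<Rightarrow> 'h::ab_group_add) \<Rightarrow> 'o set \<Rightarrow> 's \<Rightarrow> 'h" where
  "coboundary \<psi> a z = (\<Sum>y\<in>a. sgn_pow (rank_in y a) (\<psi> (a - {y}) z))"

definition inter_dom :: "('o \<Rightarrow> 's set) \<Rightarrow> 'o set \<Rightarrow> 's set" where
  "inter_dom x a = (\<Inter>y\<in>a. x y)"

definition fsets :: "nat \<Rightarrow> 'o set \<Rightarrow> 'o set set" where
  "fsets n I = {a. finite a \<and> a \<subseteq> I \<and> card a = n}"

text \<open>The set \<open>D\<close> cuts all domains down simultaneously. Intersecting it with
  \<open>x \<xi>\<close> gives families along the sets \<open>x \<alpha> \<inter> x \<xi>\<close>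
  without changing \<open>x\<close>, which is how the arguments below descend by one degree.\<close>

definition coh_sets :: "nat \<Rightarrow> 'o::linorder set \<Rightarrow> 's set \<Rightarrow> ('o \<Rightarrow> 's set) \<Rightarrow>
    ('o set \<Rightarrow> 's \<Rightarrow> 'h::ab_group_add) \<Rightarrow> bool" where
  "coh_sets n I D x \<phi> \<longleftrightarrow> (\<forall>a\<in>fsets (Suc n) I. eq_fin_on (D \<inter> inter_dom x a) (coboundary \<phi> a) (\<lambda>_. 0))"

text \<open>For \<open>n = 0\<close> the coboundary vanishes, so this says that \<open>\<phi> {}\<close> is almost zero on \<open>D\<close>.\<close>

definition triv_sets :: "'h set \<Rightarrow> nat \<Rightarrow> 'o::linorder set \<Rightarrow> 's set \<Rightarrow> ('o \<Rightarrow> 's set) \<Rightarrow>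
    ('o set \<Rightarrow> 's \<Rightarrow> 'h::ab_group_add) \<Rightarrow> bool" where
  "triv_sets K n I D x \<phi> \<longleftrightarrow> (\<exists>\<psi>. (\<forall>a z. \<psi> a z \<in> K) \<and>
     (\<forall>a\<in>fsets n I. eq_fin_on (D \<inter> inter_dom x a) (\<phi> a) (coboundary \<psi> a)))"

definition subgrp :: "'h::ab_group_add set \<Rightarrow> bool" where
  "subgrp K \<longleftrightarrow> 0 \<in> K \<and> (\<forall>a\<in>K. \<forall>b\<in>K. a - b \<in> K)"

lemma subgrp_closed:
  assumes "subgrp K"
  shows "0 \<in> K" "a \<in> K \<Longrightarrow> b \<in> K \<Longrightarrow> a - b \<in> K" "a \<in> K \<Longrightarrow> - a \<in> K"
    "a \<in> K \<Longrightarrow> b \<in> K \<Longrightarrow> a + b \<in> K" "a \<in> K \<Longrightarrow> sgn_pow k a \<in> K"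
proof -
  show 1: "0 \<in> K" and 2: "\<And>a b. a \<in> K \<Longrightarrow> b \<in> K \<Longrightarrow> a - b \<in> K"
    using assms by (auto simp: subgrp_def)
  show 3: "\<And>a. a \<in> K \<Longrightarrow> - a \<in> K" using 2[OF 1] by simp
  then show "\<And>a b. a \<in> K \<Longrightarrow> b \<in> K \<Longrightarrow> a + b \<in> K" using 2
    by (metis diff_minus_eq_add)
  show "\<And>a. a \<in> K \<Longrightarrow> sgn_pow k a \<in> K" using 3 by (auto simp: sgn_pow_def)
qed

lemma coboundary_add: "coboundary (\<lambda>a z. \<phi> a z + \<psi> a z) a z = coboundary \<phi> a z + coboundary \<psi> a z"
  by (simp add: coboundary_def sgn_pow_add sum.distrib)

lemma coboundary_diff: "coboundary (\<lambda>a z. \<phi> a z - \<psi> a z) a z = coboundary \<phi> a z - coboundary \<psi> a z"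
  by (simp add: coboundary_def sgn_pow_diff sum_subtractf)

lemma coboundary_sg: "coboundary (\<lambda>a z. sgn_pow k (\<phi> a z)) a z = sgn_pow k (coboundary \<phi> a z)"
  by (simp add: coboundary_def sgn_pow_sum sgn_pow_sg add.commute)

lemma coboundary_cong:
  "(\<And>y. y \<in> a \<Longrightarrow> \<phi> (a - {y}) z = \<psi> (a - {y}) z) \<Longrightarrow> coboundary \<phi> a z = coboundary \<psi> a z"
  by (simp add: coboundary_def)

lemma coboundary_empty [simp]: "coboundary \<phi> {} z = 0"
  by (simp add: coboundary_def)

text \<open>The vertex \<beta> has rank \<open>card a\<close>, and adding it on top leaves the other
  ranks alone. The recursions below rest on this identity: the first summand lives on sets
  containing \<beta>, the second on what is already fixed below \<beta>.\<close>

lemma coboundary_insert_top: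
  assumes "finite a" "\<And>y. y \<in> a \<Longrightarrow> y < \<beta>"
  shows "coboundary \<phi> (insert \<beta> a) z = coboundary (\<lambda>s. \<phi> (insert \<beta> s)) a z + sgn_pow (card a) (\<phi> a z)"
proof -
  have nb: "\<beta> \<notin> a" using assms(2) by blast
  have r1: "rank_in \<beta> (insert \<beta> a) = card a"
    unfolding rank_in_def by (rule arg_cong[where f=card]) (use assms(2) in auto)
  have r2: "rank_in y (insert \<beta> a) = rank_in y a" if "y \<in> a" for y
    unfolding rank_in_def using assms(2)[OF that] by (intro arg_cong[where f=card]) auto
  have d: "insert \<beta> a - {y} = insert \<beta> (a - {y})" if "y \<in> a" for y
    using nb that by auto
  have "coboundary \<phi> (insert \<beta> a) z = sgn_pow (card a) (\<phi> a z)
      + (\<Sum>y\<in>a. sgn_pow (rank_in y (insert \<beta> a)) (\<phi> (insert \<beta> a - {y}) z))"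
    unfolding coboundary_def using assms(1) nb by (simp add: r1)
  also have "(\<Sum>y\<in>a. sgn_pow (rank_in y (insert \<beta> a)) (\<phi> (insert \<beta> a - {y}) z))
      = coboundary (\<lambda>s. \<phi> (insert \<beta> s)) a z"
    unfolding coboundary_def by (rule sum.cong) (simp_all add: r2 d)
  finally show ?thesis by (simp add: add.commute)
qed

section \<open>Change of order on the index set\<close>

text \<open>The parity of this number is the sign of the permutation relating the order of
  \<open>a\<close> to the one pulled back along \<open>g\<close>. It lets cochains be transported
  along injections that are not monotone.\<close>

definition swaps :: "('o::linorder \<Rightarrow> 'p::linorder) \<Rightarrow> 'o set \<Rightarrow> nat" where
  "swaps g a = card {(y, z). y \<in> a \<and> z \<in> a \<and> y < z \<and> g z < g y}"

text \<open>The inversions involving \<open>y\<close> are counted by \<open>A\<close> and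
  \<open>B\<close>. The elements of \<open>L\<close>, below \<open>y\<close> in both orders, enter
  both ranks, \<open>card B + card L\<close> and \<open>card A + card L\<close>, and cancel modulo
  2.\<close>

lemma swaps_remove:
  assumes "finite a" "y \<in> a" "inj_on g a"
  shows "even (swaps g a + swaps g (a - {y}) + rank_in y a + rank_in (g y) (g ` a))"
proof -
  let ?P = "{(u, v). u \<in> a \<and> v \<in> a \<and> u < v \<and> g v < g u}"
  let ?Q = "{(u, v). u \<in> a - {y} \<and> v \<in> a - {y} \<and> u < v \<and> g v < g u}"
  define A where "A = {v\<in>a. y < v \<and> g v < g y}"
  define B where "B = {u\<in>a. u < y \<and> g y < g u}"
  define L where "L = {u\<in>a. u < y \<and> g u < g y}"
  have fin: "finite A" "finite B" "finite L" "finite ?Q"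
    using assms(1) finite_subset[of ?Q "a \<times> a"] by (auto simp: A_def B_def L_def)
  have "?P = ?Q \<union> (Pair y ` A \<union> (\<lambda>u. (u, y)) ` B)"
    using assms(2) by (auto simp: A_def B_def)
  moreover have "?Q \<inter> (Pair y ` A \<union> (\<lambda>u. (u, y)) ` B) = {}"
    "Pair y ` A \<inter> (\<lambda>u. (u, y)) ` B = {}"
    by (auto simp: A_def B_def)
  moreover have "card (Pair y ` A) = card A" "card ((\<lambda>u. (u, y)) ` B) = card B"
    by (auto intro!: card_image inj_onI)
  ultimately have e: "swaps g a = swaps g (a - {y}) + (card A + card B)"
    unfolding swaps_def using fin by (simp add: card_Un_disjoint)
  have gne: "g u < g y \<or> g y < g u" if "u \<in> a" "u < y \<or> y < u" for u
    using assms(2,3) that by (metis inj_onD less_irrefl linorder_neqE)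
  have "{u\<in>a. u < y} = B \<union> L"
    using gne unfolding B_def L_def by blast
  moreover have "card (B \<union> L) = card B + card L"
    by (rule card_Un_disjoint) (use fin in \<open>auto simp: B_def L_def\<close>)
  ultimately have r1: "rank_in y a = card B + card L"
    unfolding rank_in_def by simp
  have "u \<in> A \<union> L" if "u \<in> a" "g u < g y" for u
    using that linorder_neqE[of u y] by (auto simp: A_def L_def)
  then have "{v\<in>g ` a. v < g y} = g ` (A \<union> L)"
    by (auto simp: A_def L_def)
  moreover have "card (g ` (A \<union> L)) = card (A \<union> L)"
    by (rule card_image, rule inj_on_subset[OF assms(3)]) (auto simp: A_def L_def)
  moreover have "card (A \<union> L) = card A + card L"
    by (rule card_Un_disjoint) (use fin in \<open>auto simp: A_def L_def\<close>)
  ultimately have r2: "rank_in (g y) (g ` a) = card A + card L"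
    unfolding rank_in_def by simp
  show ?thesis unfolding e r1 r2 by auto
qed

lemma coboundary_reindex:
  assumes "finite b" "inj_on g b"
  shows "coboundary (\<lambda>a z. sgn_pow (swaps g a) (\<phi> (g ` a) z)) b z = sgn_pow (swaps g b) (coboundary \<phi> (g ` b) z)"
proof -
  have "coboundary \<phi> (g ` b) z = (\<Sum>y\<in>b. sgn_pow (rank_in (g y) (g ` b)) (\<phi> (g ` b - {g y}) z))"
    unfolding coboundary_def by (simp add: sum.reindex[OF assms(2)])
  also have "sgn_pow (swaps g b) \<dots> =
      (\<Sum>y\<in>b. sgn_pow (rank_in y b) (sgn_pow (swaps g (b - {y})) (\<phi> (g ` (b - {y})) z)))"
    unfolding sgn_pow_sum
  proof (rule sum.cong)
    fix y assume y: "y \<in> b"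
    have "g ` (b - {y}) = g ` b - {g y}"
      using inj_on_image_set_diff[OF assms(2), of b "{y}"] y by simp
    moreover have "even (swaps g b + rank_in (g y) (g ` b) + (rank_in y b + swaps g (b - {y})))"
      using swaps_remove[OF assms(1) y assms(2)] by (simp add: ac_simps)
    ultimately show "sgn_pow (swaps g b) (sgn_pow (rank_in (g y) (g ` b)) (\<phi> (g ` b - {g y}) z)) =
        sgn_pow (rank_in y b) (sgn_pow (swaps g (b - {y})) (\<phi> (g ` (b - {y})) z))"
      unfolding sgn_pow_sg by (simp only: sgn_pow_cong)
  qed simp
  finally show ?thesis by (simp add: coboundary_def)
qed

lemma coh_sets_reindex:
  assumes "inj_on g J" "coh_sets n (g ` J) D x \<phi>"
  shows "coh_sets n J D (x \<circ> g) (\<lambda>a z. sgn_pow (swaps g a) (\<phi> (g ` a) z))"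
  unfolding coh_sets_def
proof
  fix a assume a: "a \<in> fsets (Suc n) J"
  then have inj: "inj_on g a" and fin: "finite a"
    using assms(1) by (auto simp: fsets_def intro: inj_on_subset)
  have "g ` a \<in> fsets (Suc n) (g ` J)"
    using a inj by (auto simp: fsets_def card_image)
  then have "eq_fin_on (D \<inter> inter_dom x (g ` a)) (coboundary \<phi> (g ` a)) (\<lambda>_. 0)"
    using assms(2) by (auto simp: coh_sets_def)
  then show "eq_fin_on (D \<inter> inter_dom (x \<circ> g) a) (coboundary (\<lambda>a z. sgn_pow (swaps g a) (\<phi> (g ` a) z)) a) (\<lambda>_. 0)"
    unfolding eq_fin_on_def coboundary_reindex[OF fin inj] by (simp add: inter_dom_def)
qed

lemma triv_sets_reindex:
  assumes "inj_on g J" "subgrp K"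
    and "triv_sets K n J D (x \<circ> g) (\<lambda>a z. sgn_pow (swaps g a) (\<phi> (g ` a) z))"
  shows "triv_sets K n (g ` J) D x \<phi>"
proof -
  obtain \<psi>' where K: "\<And>a z. \<psi>' a z \<in> K" and \<psi>': "\<And>a. a \<in> fsets n J \<Longrightarrow>
      eq_fin_on (D \<inter> inter_dom (x \<circ> g) a) (\<lambda>z. sgn_pow (swaps g a) (\<phi> (g ` a) z)) (coboundary \<psi>' a)"
    using assms(3) unfolding triv_sets_def by blast
  define f where "f = inv_into J g"
  have fg: "f ` g ` b = b" if "b \<subseteq> J" for b
    using assms(1) that by (simp add: f_def)
  define \<psi> where "\<psi> = (\<lambda>a z. sgn_pow (swaps g (f ` a)) (\<psi>' (f ` a) z))"
  show ?thesis unfolding triv_sets_def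
  proof (intro exI[of _ \<psi>] conjI allI ballI)
    show "\<psi> a z \<in> K" for a z
      using K subgrp_closed[OF assms(2)] by (auto simp: \<psi>_def)
    fix a assume a: "a \<in> fsets n (g ` J)"
    define b where "b = f ` a"
    have gb: "g ` b = a" and bJ: "b \<subseteq> J" and fin: "finite b"
      using a image_inv_into_cancel[OF refl, of a g J]
      by (auto simp: b_def f_def fsets_def inv_into_into)
    have inj: "inj_on g b" using assms(1) bJ by (rule inj_on_subset)
    have "b \<in> fsets n J" using a gb bJ fin inj by (auto simp: fsets_def card_image)
    from \<psi>'[OF this] have ev: "\<forall>\<^sub>F z in cofinite. z \<in> D \<inter> inter_dom (x \<circ> g) b \<longrightarrow>
        sgn_pow (swaps g b) (\<phi> a z) = coboundary \<psi>' b z"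
      unfolding eq_fin_on_eventually gb .
    have d: "coboundary \<psi>' b z = sgn_pow (swaps g b) (coboundary \<psi> a z)" for z
    proof -
      have "coboundary \<psi>' b z = coboundary (\<lambda>a z. sgn_pow (swaps g a) (\<psi> (g ` a) z)) b z"
      proof (rule coboundary_cong)
        fix y
        have "f ` g ` (b - {y}) = b - {y}" by (rule fg) (use bJ in auto)
        then show "\<psi>' (b - {y}) z = sgn_pow (swaps g (b - {y})) (\<psi> (g ` (b - {y})) z)"
          by (simp add: \<psi>_def sgn_pow_sg sgn_pow_def)
      qed
      then show ?thesis using coboundary_reindex[OF fin inj] gb by simp
    qed
    have X: "inter_dom (x \<circ> g) b = inter_dom x a" using gb by (auto simp: inter_dom_def)
    show "eq_fin_on (D \<inter> inter_dom x a) (\<phi> a) (coboundary \<psi> a)"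
      unfolding eq_fin_on_eventually using ev unfolding d X
      by eventually_elim (auto simp: sgn_pow_def split: if_splits)
  qed
qed

lemma coh_sets_cong_x: "(\<And>i. i \<in> I \<Longrightarrow> x i = y i) \<Longrightarrow> coh_sets n I D x \<phi> = coh_sets n I D y \<phi>"
proof -
  assume h: "\<And>i. i \<in> I \<Longrightarrow> x i = y i"
  have "inter_dom x a = inter_dom y a" if "a \<in> fsets (Suc n) I" for a
    using h that by (auto simp: inter_dom_def fsets_def)
  then show ?thesis by (simp add: coh_sets_def)
qed

lemma triv_sets_cong_x: "(\<And>i. i \<in> I \<Longrightarrow> x i = y i) \<Longrightarrow> triv_sets K n I D x \<phi> = triv_sets K n I D y \<phi>"
proof -
  assume h: "\<And>i. i \<in> I \<Longrightarrow> x i = y i"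
  have "inter_dom x a = inter_dom y a" if "a \<in> fsets n I" for a
    using h that by (auto simp: inter_dom_def fsets_def)
  then show ?thesis by (simp add: triv_sets_def)
qed

lemma triv_sets_diff:
  assumes "subgrp K" "triv_sets K n I D x \<phi>" "triv_sets K n I D x \<phi>'"
  shows "triv_sets K n I D x (\<lambda>a z. \<phi> a z - \<phi>' a z)"
proof -
  obtain \<psi> where p: "\<And>a z. \<psi> a z \<in> K" "\<And>a. a\<in>fsets n I \<Longrightarrow> eq_fin_on (D \<inter> inter_dom x a) (\<phi> a) (coboundary \<psi> a)"
    using assms(2) unfolding triv_sets_def by blast
  obtain \<psi>' where q: "\<And>a z. \<psi>' a z \<in> K" "\<And>a. a\<in>fsets n I \<Longrightarrow> eq_fin_on (D \<inter> inter_dom x a) (\<phi>' a) (coboundary \<psi>' a)"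
    using assms(3) unfolding triv_sets_def by blast
  show ?thesis unfolding triv_sets_def
  proof (intro exI[of _ "\<lambda>a z. \<psi> a z - \<psi>' a z"] conjI allI ballI)
    show "\<psi> a z - \<psi>' a z \<in> K" for a z using p q subgrp_closed[OF assms(1)] by blast
    fix a assume "a \<in> fsets n I"
    from p(2)[OF this] q(2)[OF this]
    show "eq_fin_on (D \<inter> inter_dom x a) (\<lambda>z. \<phi> a z - \<phi>' a z) (coboundary (\<lambda>a z. \<psi> a z - \<psi>' a z) a)"
      unfolding eq_fin_on_eventually coboundary_diff by eventually_elim auto
  qed
qed

section \<open>Families determined by their values at the maximal index\<close>

lemma fsets_insert_top:
  assumes "a \<in> fsets n I" "\<beta> \<in> J" "I \<subseteq> J" "\<beta> \<notin> a"
  shows "insert \<beta> a \<in> fsets (Suc n) J"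
  using assms by (auto simp: fsets_def)

lemma fsets_remove_Max:
  assumes "a \<in> fsets (Suc n) I"
  shows "Max a \<in> I" "a - {Max a} \<in> fsets n (I \<inter> {..<Max a})" "insert (Max a) (a - {Max a}) = a"
proof -
  have a: "finite a" "a \<subseteq> I" "card a = Suc n" "a \<noteq> {}"
    using assms by (auto simp: fsets_def)
  then have m: "Max a \<in> a" by simp
  then show "Max a \<in> I" "insert (Max a) (a - {Max a}) = a" using a(2) by blast+
  have "y < Max a" if "y \<in> a" "y \<noteq> Max a" for y
    using Max_ge[OF a(1) that(1)] that(2) by simp
  then show "a - {Max a} \<in> fsets n (I \<inter> {..<Max a})"
    using a(1-3) m by (auto simp: fsets_def)
qed

text \<open>Made for recursion on the top vertex: \<open>f \<beta>\<close> is the part of the family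
  on sets with maximum \<beta>, regarded as a family of one degree less on subsets of
  \<beta>.\<close>

definition glue :: "('o::linorder \<Rightarrow> 'o set \<Rightarrow> 's \<Rightarrow> 'h) \<Rightarrow> 'o set \<Rightarrow> 's \<Rightarrow> 'h" where
  "glue f a = f (Max a) (a - {Max a})"

lemma Max_insert_top: "finite a \<Longrightarrow> (\<And>y. y \<in> a \<Longrightarrow> y < \<beta>) \<Longrightarrow> Max (insert \<beta> a) = (\<beta>::'o::linorder)"
  by (rule Max_eqI) (auto intro: less_imp_le)

lemma glue_insert_top:
  assumes "finite a" "\<And>y. y \<in> a \<Longrightarrow> y < \<beta>"
  shows "glue f (insert \<beta> a) = f \<beta> a"
proof -
  have "insert \<beta> a - {\<beta>} = a" "Max (insert \<beta> a) = \<beta>"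
    using assms(2) Max_insert_top[OF assms] by auto
  then show ?thesis unfolding glue_def by presburger
qed

lemma coboundary_glue:
  assumes "finite a" "\<And>y. y \<in> a \<Longrightarrow> y < \<beta>"
  shows "coboundary (glue f) (insert \<beta> a) z = coboundary (f \<beta>) a z + sgn_pow (card a) (glue f a z)"
proof -
  have "coboundary (\<lambda>s. glue f (insert \<beta> s)) a z = coboundary (f \<beta>) a z"
    by (rule coboundary_cong) (subst glue_insert_top, use assms in auto)
  then show ?thesis by (simp add: coboundary_insert_top[OF assms])
qed

lemma glue_cong:
  assumes "a \<in> fsets (Suc n) I" "\<And>\<eta>. \<eta> \<in> I \<Longrightarrow> f \<eta> = f' \<eta>"
  shows "glue f a = glue f' a"
  unfolding glue_def using fsets_remove_Max(1)[OF assms(1)] assms(2) by simp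


section \<open>The ordinals \<open>\<omega>\<^sub>k\<close>\<close>

lemma omega_downward: "\<alpha> \<in> omega n \<Longrightarrow> \<beta> \<le> \<alpha> \<Longrightarrow> \<beta> \<in> (omega n :: 'o::wellorder set)"
proof (cases n)
  case 0
  assume "\<alpha> \<in> omega n" "\<beta> \<le> \<alpha>"
  then show ?thesis using 0 finite_subset[of "{..<\<beta>}" "{..<\<alpha>}"] by auto
next
  case (Suc k)
  assume "\<alpha> \<in> omega n" "\<beta> \<le> \<alpha>"
  then have "|{..<\<beta>}| \<le>o |{..<\<alpha>}|" "|{..<\<alpha>}| \<le>o |omega k :: 'o set|"
    using Suc by (auto intro!: card_of_mono1)
  then show ?thesis using Suc ordLeq_transitive by auto
qed

lemma lessThan_subset_omega: "\<alpha> \<in> omega n \<Longrightarrow> {..<\<alpha>} \<subseteq> (omega n :: 'o::wellorder set)"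
  using omega_downward by fastforce

section \<open>Cardinal arithmetic below an infinite set\<close>

lemma countable_ordLeq_infinite:
  assumes "countable A" "infinite B"
  shows "|A| \<le>o |B|"
proof (rule ordLeq_transitive)
  show "|A| \<le>o |UNIV :: nat set|"
    using assms(1) unfolding countable_def card_of_ordLeq[symmetric] by blast
  show "|UNIV :: nat set| \<le>o |B|"
    using assms(2) unfolding infinite_iff_card_of_nat .
qed

lemma card_of_Un_infinite:
  assumes "infinite B" "|A| \<le>o |B|" "|A'| \<le>o |B|"
  shows "|A \<union> A'| \<le>o |B|"
proof -
  have "A \<union> A' = (\<Union>i\<in>UNIV. if i then A else A')" by (simp add: UNIV_bool Un_commute)
  moreover have "|\<Union>i\<in>UNIV. if i then A else A'| \<le>o |B|"
    using assms by (intro card_of_UNION_ordLeq_infinite countable_ordLeq_infinite) auto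
  ultimately show ?thesis by simp
qed

lemma card_of_lists_ordLeq_infinite:
  assumes "infinite B" "|A| \<le>o |B|"
  shows "|lists A| \<le>o |B|"
proof -
  let ?L = "\<lambda>n. {l. set l \<subseteq> A \<and> length l = n}"
  have n: "|?L n| \<le>o |B|" for n
  proof (induction n)
    case 0
    have "?L 0 = {[]}" by auto
    then show ?case using assms(1) by (metis countable_empty countable_insert countable_ordLeq_infinite)
  next
    case (Suc n)
    have "?L (Suc n) \<subseteq> case_prod Cons ` (A \<times> ?L n)"
      by (auto simp: length_Suc_conv image_iff)
    then have "|?L (Suc n)| \<le>o |A \<times> ?L n|"
      by (meson card_of_image card_of_mono1 ordLeq_transitive)
    also have "|A \<times> ?L n| \<le>o |B|"
      using assms Suc by (intro card_of_Sigma_ordLeq_infinite) auto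
    finally show ?case .
  qed
  have "lists A = (\<Union>n\<in>UNIV. ?L n)" by auto
  moreover have "|\<Union>n\<in>UNIV. ?L n| \<le>o |B|"
    using n assms(1) by (intro card_of_UNION_ordLeq_infinite) (auto intro: countable_ordLeq_infinite)
  ultimately show ?thesis by simp
qed

lemma card_of_Fpow_ordLeq_infinite:
  assumes "infinite B" "|A| \<le>o |B|"
  shows "|Fpow A| \<le>o |B|"
proof -
  have "Fpow A \<subseteq> set ` lists A"
    unfolding Fpow_def using finite_list by (fastforce simp: image_iff)
  then have "|Fpow A| \<le>o |lists A|"
    by (meson card_of_image card_of_mono1 ordLeq_transitive)
  then show ?thesis using card_of_lists_ordLeq_infinite[OF assms] ordLeq_transitive by blast
qed

section \<open>Regularity and closure points\<close>

context
  fixes n :: nat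
  assumes om: "omegas_exist TYPE('o::wellorder) n"
begin

lemma omega_infinite: "k \<le> n \<Longrightarrow> infinite (omega k :: 'o set)"
proof (induction k)
  case 0
  then show ?case using om infinite_iff_natLeq_ordLeq ordIso_iff_ordLeq
    unfolding omegas_exist_def by blast
next
  case (Suc k)
  then have "|omega k :: 'o set| <o |omega (Suc k) :: 'o set|"
    using om cardSuc_greater[OF card_of_Card_order] ordIso_symmetric ordLess_ordIso_trans
    unfolding omegas_exist_def by (metis Suc_le_lessD)
  then have "|omega k :: 'o set| \<le>o |omega (Suc k) :: 'o set|"
    by (rule ordLess_imp_ordLeq)
  then show ?case using Suc card_of_ordLeq_infinite by auto
qed

lemma omega_Suc_less: "k < n \<Longrightarrow> |omega k :: 'o set| <o |omega (Suc k) :: 'o set|"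
  using om cardSuc_greater[OF card_of_Card_order] ordIso_symmetric ordLess_ordIso_trans
  unfolding omegas_exist_def by metis

lemma countable_omega_0: "countable (omega 0 :: 'o set)"
proof -
  have "|omega 0 :: 'o set| =o |UNIV :: nat set|"
    using om ordIso_transitive[OF _ ordIso_symmetric[OF card_of_nat]]
    unfolding omegas_exist_def by blast
  then show ?thesis unfolding card_of_ordIso[symmetric] countable_def bij_betw_def by blast
qed

lemma omega_le: "j \<le> k \<Longrightarrow> k \<le> n \<Longrightarrow> |omega j :: 'o set| \<le>o |omega k :: 'o set|"
proof (induction k)
  case (Suc k)
  then show ?case
  proof (cases "j = Suc k")
    case False
    then have "|omega j :: 'o set| \<le>o |omega k :: 'o set|" using Suc by auto
    then show ?thesis using omega_Suc_less[of k] Suc.prems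
      by (meson Suc_le_lessD ordLeq_ordLess_trans ordLess_imp_ordLeq)
  qed (auto intro: card_of_refl ordIso_imp_ordLeq)
qed (auto intro: card_of_refl ordIso_imp_ordLeq)

text \<open>Regularity of omega_(k+1): an unbounded \<open>A\<close> would cover it by at most
  omega_k initial segments, each of size at most omega_k.\<close>

lemma omega_bounded_Suc:
  assumes "Suc k \<le> n" "A \<subseteq> omega (Suc k)" "|A| \<le>o |omega k :: 'o set|"
  shows "\<exists>\<xi>\<in>omega (Suc k). A \<subseteq> {..<\<xi>::'o}"
proof (rule ccontr)
  assume no: "\<not> ?thesis"
  have "omega (Suc k) \<subseteq> (\<Union>\<alpha>\<in>A. {..\<alpha>})"
  proof
    fix \<xi> :: 'o assume "\<xi> \<in> omega (Suc k)"
    then obtain \<alpha> where "\<alpha> \<in> A" "\<not> \<alpha> < \<xi>" using no by blast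
    then show "\<xi> \<in> (\<Union>\<alpha>\<in>A. {..\<alpha>})" by (auto simp: not_less)
  qed
  then have "|omega (Suc k) :: 'o set| \<le>o |\<Union>\<alpha>\<in>A. {..\<alpha>}|" by (rule card_of_mono1)
  also have "|\<Union>\<alpha>\<in>A. {..\<alpha>}| \<le>o |omega k :: 'o set|"
  proof (rule card_of_UNION_ordLeq_infinite)
    show inf: "infinite (omega k :: 'o set)" using assms(1) by (intro omega_infinite) simp
    show "\<forall>\<alpha>\<in>A. |{..\<alpha>}| \<le>o |omega k :: 'o set|"
    proof
      fix \<alpha> assume "\<alpha> \<in> A"
      then have "|{..<\<alpha>}| \<le>o |omega k :: 'o set|" using assms(2) by auto
      moreover have "|{\<alpha>}| \<le>o |omega k :: 'o set|" using inf by (intro countable_ordLeq_infinite) auto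
      ultimately have "|{..<\<alpha>} \<union> {\<alpha>}| \<le>o |omega k :: 'o set|"
        using inf by (intro card_of_Un_infinite) auto
      moreover have "{..<\<alpha>} \<union> {\<alpha>} = {..\<alpha>}" by auto
      ultimately show "|{..\<alpha>}| \<le>o |omega k :: 'o set|" by simp
    qed
  qed (fact assms(3))
  finally show False using omega_Suc_less[of k] assms(1) not_ordLess_ordLeq by auto
qed

lemma omega_bounded_image:
  fixes \<xi> :: 'o
  assumes "k \<le> n" "\<xi> \<in> omega k" "f ` {..<\<xi>} \<subseteq> omega k"
  shows "\<exists>\<eta>\<in>omega k. f ` {..<\<xi>} \<subseteq> {..<\<eta>::'o}"
proof (cases k)
  case 0
  then have fin: "finite {..<\<xi>}" using assms(2) by simp
  have inf: "infinite (omega 0 :: 'o set)" by (rule omega_infinite) simp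
  have "infinite (omega 0 - (\<Union>\<alpha>\<in>f ` {..<\<xi>}. {..\<alpha>}))"
  proof (intro Diff_infinite_finite[rotated] inf finite_UN_I)
    fix \<alpha> assume "\<alpha> \<in> f ` {..<\<xi>}"
    then have "finite {..<\<alpha>}" using assms(3) 0 by auto
    moreover have "{..\<alpha>} = insert \<alpha> {..<\<alpha>}" by auto
    ultimately show "finite {..\<alpha>}" by simp
  qed (use fin in auto)
  then obtain \<eta> where "\<eta> \<in> omega 0 - (\<Union>\<alpha>\<in>f ` {..<\<xi>}. {..\<alpha>})"
    by (metis finite.emptyI equals0I)
  then show ?thesis using 0 by (auto intro!: bexI[of _ \<eta>] simp: not_le)
next
  case (Suc j)
  have "|f ` {..<\<xi>}| \<le>o |omega j :: 'o set|"
    using ordLeq_transitive[OF card_of_image[of f "{..<\<xi>}"]] assms(2) Suc by simp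
  then show ?thesis using omega_bounded_Suc[of j] assms Suc by auto
qed

text \<open>The closing-off argument: iterate a function \<open>u\<close> that bounds
  \<open>V\<close> on initial segments. The countable range of the iterates is bounded by
  regularity, and its least bound is closed under \<open>V\<close> because the iterates are cofinal
  in it.\<close>

lemma club_closure:
  fixes V :: "'o \<Rightarrow> 'o set"
  assumes k: "Suc k \<le> n"
    and V: "\<And>\<xi>. \<xi> \<in> omega (Suc k) \<Longrightarrow> V \<xi> \<subseteq> omega (Suc k) \<and> |V \<xi>| \<le>o |omega k :: 'o set|"
  shows "club (omega (Suc k)) {\<beta> \<in> omega (Suc k). {..<\<beta>} \<noteq> {} \<and> (\<forall>\<xi><\<beta>. V \<xi> \<subseteq> {..<\<beta>})}"
    (is "club ?O ?C")
  unfolding club_def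
proof (intro conjI ballI impI)
  show "?C \<subseteq> ?O" by blast
next
  fix \<alpha> assume a: "\<alpha> \<in> ?O" and lim: "{..<\<alpha>} \<noteq> {} \<and> (\<forall>\<xi><\<alpha>. \<exists>\<gamma>\<in>?C. \<xi> < \<gamma> \<and> \<gamma> < \<alpha>)"
  have "V \<xi> \<subseteq> {..<\<alpha>}" if \<xi>: "\<xi> < \<alpha>" for \<xi>
  proof -
    obtain \<gamma> where "V \<xi> \<subseteq> {..<\<gamma>}" "\<gamma> < \<alpha>" using lim \<xi> by blast
    then show ?thesis by (meson lessThan_subset_iff less_imp_le subset_trans)
  qed
  then show "\<alpha> \<in> ?C" using a lim by blast
next
  fix \<xi>0 assume \<xi>0: "\<xi>0 \<in> ?O"
  have inf: "infinite (omega k :: 'o set)" using k by (intro omega_infinite) simp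
  have "\<forall>\<xi>\<in>?O. \<exists>\<eta>\<in>?O. \<xi> < \<eta> \<and> (\<forall>\<zeta>\<le>\<xi>. V \<zeta> \<subseteq> {..<\<eta>})"
  proof
    fix \<xi> assume \<xi>: "\<xi> \<in> ?O"
    have sub: "{..\<xi>} \<subseteq> ?O" using omega_downward[OF \<xi>] by (auto simp del: omega.simps)
    have "|{..<\<xi>}| \<le>o |omega k :: 'o set|" using \<xi> by simp
    moreover have "|{\<xi>}| \<le>o |omega k :: 'o set|" using inf by (intro countable_ordLeq_infinite) auto
    ultimately have "|{..<\<xi>} \<union> {\<xi>}| \<le>o |omega k :: 'o set|"
      using inf by (intro card_of_Un_infinite) auto
    moreover have "{..<\<xi>} \<union> {\<xi>} = {..\<xi>}" by auto
    ultimately have c: "|{..\<xi>}| \<le>o |omega k :: 'o set|" by simp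
    have "|{..\<xi>} \<union> (\<Union>\<zeta>\<in>{..\<xi>}. V \<zeta>)| \<le>o |omega k :: 'o set|"
    proof (intro card_of_Un_infinite card_of_UNION_ordLeq_infinite inf c)
      show "\<forall>\<zeta>\<in>{..\<xi>}. |V \<zeta>| \<le>o |omega k :: 'o set|" using V sub by blast
    qed
    moreover have "{..\<xi>} \<union> (\<Union>\<zeta>\<in>{..\<xi>}. V \<zeta>) \<subseteq> ?O"
      using sub V by blast
    ultimately obtain \<eta> where "\<eta> \<in> ?O" "{..\<xi>} \<union> (\<Union>\<zeta>\<in>{..\<xi>}. V \<zeta>) \<subseteq> {..<\<eta>}"
      using omega_bounded_Suc[OF k] by meson
    then show "\<exists>\<eta>\<in>?O. \<xi> < \<eta> \<and> (\<forall>\<zeta>\<le>\<xi>. V \<zeta> \<subseteq> {..<\<eta>})"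
      by (intro bexI[of _ \<eta>]) auto
  qed
  then obtain u where u: "\<And>\<xi>. \<xi> \<in> ?O \<Longrightarrow> u \<xi> \<in> ?O \<and> \<xi> < u \<xi> \<and> (\<forall>\<zeta>\<le>\<xi>. V \<zeta> \<subseteq> {..<u \<xi>})"
    by metis
  define s where "s = (\<lambda>i::nat. (u ^^ i) \<xi>0)"
  have sO: "s i \<in> ?O" for i by (induction i) (use \<xi>0 u in \<open>auto simp: s_def\<close>)
  have sS: "s (Suc i) = u (s i)" for i by (simp add: s_def)
  have "|range s| \<le>o |omega k :: 'o set|" using inf by (intro countable_ordLeq_infinite) auto
  then have ex: "\<exists>\<beta>. \<beta> \<in> ?O \<and> range s \<subseteq> {..<\<beta>}"
    using omega_bounded_Suc[OF k, of "range s"] sO by blast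
  define \<beta> where "\<beta> = (LEAST \<beta>. \<beta> \<in> ?O \<and> range s \<subseteq> {..<\<beta>})"
  have \<beta>: "\<beta> \<in> ?O" "range s \<subseteq> {..<\<beta>}" using LeastI_ex[OF ex] unfolding \<beta>_def by auto
  have cof: "\<exists>i. \<xi> \<le> s i" if "\<xi> < \<beta>" for \<xi>
  proof (rule ccontr)
    assume "\<nexists>i. \<xi> \<le> s i"
    then have "range s \<subseteq> {..<\<xi>}" by (auto simp: not_le)
    moreover have "\<xi> \<in> ?O" using omega_downward[OF \<beta>(1)] that by simp
    ultimately show False using not_less_Least[of \<xi>] that unfolding \<beta>_def by blast
  qed
  have "V \<xi> \<subseteq> {..<\<beta>}" if \<xi>: "\<xi> < \<beta>" for \<xi>
  proof -
    obtain i where "\<xi> \<le> s i" using cof[OF \<xi>] by blast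
    then have "V \<xi> \<subseteq> {..<s (Suc i)}" using u[OF sO[of i]] sS by auto
    moreover have "s (Suc i) < \<beta>" using \<beta>(2) by auto
    ultimately show ?thesis by (meson lessThan_subset_iff less_imp_le subset_trans)
  qed
  moreover have "s 0 < \<beta>" using \<beta>(2) by auto
  ultimately show "\<exists>\<gamma>\<in>?C. \<xi>0 \<le> \<gamma>"
    using \<beta>(1) by (intro bexI[of _ \<beta>]) (auto simp: s_def)
qed

end

section \<open>Countable index sets\<close>

text \<open>Diagonalize along an enumeration \<open>p\<close> of \<open>I\<close>: at
  \<open>z\<close> follow the first index whose set contains \<open>z\<close>. On \<open>x j\<close>
  this differs from \<open>\<phi> {j}\<close> only through the finitely many indices enumerated
  before \<open>j\<close>, each contributing a finite error by coherence.\<close>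

lemma triv_sets_countable:
  fixes I :: "'o::wellorder set"
  assumes "countable I" "coh_sets (Suc 0) I D x \<phi>" "subgrp K" "\<And>a z. \<phi> a z \<in> K"
  shows "triv_sets K (Suc 0) I D x \<phi>"
proof -
  define p where "p = to_nat_on I"
  have inj: "inj_on p I" unfolding p_def by (rule inj_on_to_nat_on[OF assms(1)])
  define \<psi> where "\<psi> = (\<lambda>(a::'o set) z. if \<exists>i\<in>I. z \<in> x i
    then \<phi> {ARG_MIN p i. i \<in> I \<and> z \<in> x i} z else 0)"
  show ?thesis unfolding triv_sets_def
  proof (intro exI[of _ \<psi>] conjI allI ballI)
    show "\<psi> a z \<in> K" for a z using assms(4) subgrp_closed(1)[OF assms(3)] by (auto simp: \<psi>_def)
    fix a assume "a \<in> fsets (Suc 0) I"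
    then obtain j where j: "a = {j}" "j \<in> I" by (auto simp: fsets_def card_1_singleton_iff)
    have fin: "finite {i\<in>I. p i \<le> p j}"
      by (rule finite_imageD[of p]) (auto intro: inj_on_subset[OF inj] finite_subset[of _ "{..p j}"])
    have pair: "finite {z\<in>D \<inter> x i \<inter> x j. \<phi> {i} z \<noteq> \<phi> {j} z}" if i: "i \<in> I" for i
    proof (cases "i = j")
      case False
      have "coboundary \<phi> {i, j} z = 0 \<longleftrightarrow> \<phi> {i} z = \<phi> {j} z" for z
      proof -
        have *: "coboundary \<phi> {u, v} z = \<phi> {v} z - \<phi> {u} z" if "u < v" for u v
        proof -
          have "rank_in u {u, v} = 0" "rank_in v {u, v} = Suc 0"
          proof -
            have "{z \<in> {u, v}. z < u} = {}" "{z \<in> {u, v}. z < v} = {u}"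
              using that by auto
            then show "rank_in u {u, v} = 0" "rank_in v {u, v} = Suc 0" unfolding rank_in_def by simp_all
          qed
          moreover have "{u, v} - {u} = {v}" "{u, v} - {v} = {u}" using that by auto
          ultimately show ?thesis unfolding coboundary_def using that by (simp add: sgn_pow_def)
        qed
        show ?thesis
        proof (cases "i < j")
          case False
          then have "coboundary \<phi> {j, i} z = \<phi> {i} z - \<phi> {j} z" using * \<open>i \<noteq> j\<close> by simp
          then show ?thesis by (simp add: insert_commute)
        qed (use * in auto)
      qed
      moreover have "eq_fin_on (D \<inter> inter_dom x {i, j}) (coboundary \<phi> {i, j}) (\<lambda>_. 0)"
        using assms(2) i j False by (auto simp: coh_sets_def fsets_def)
      ultimately show ?thesis by (simp add: eq_fin_on_def inter_dom_def Int_assoc)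
    qed simp
    have "{z\<in>D \<inter> inter_dom x a. \<phi> a z \<noteq> coboundary \<psi> a z} \<subseteq>
        (\<Union>i\<in>{i\<in>I. p i \<le> p j}. {z\<in>D \<inter> x i \<inter> x j. \<phi> {i} z \<noteq> \<phi> {j} z})"
    proof
      fix z assume z: "z \<in> {z\<in>D \<inter> inter_dom x a. \<phi> a z \<noteq> coboundary \<psi> a z}"
      then have zj: "z \<in> D" "z \<in> x j" using j by (auto simp: inter_dom_def)
      define i where "i = (ARG_MIN p i. i \<in> I \<and> z \<in> x i)"
      have i: "i \<in> I \<and> z \<in> x i" "p i \<le> p j"
        using arg_min_nat_lemma[of "\<lambda>i. i \<in> I \<and> z \<in> x i" j p] j zj by (auto simp: i_def)
      have "coboundary \<psi> a z = \<phi> {i} z"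
      proof -
        have "{z \<in> {j}. z < j} = {}" by auto
        then have "rank_in j {j} = 0" unfolding rank_in_def by simp
        then have "coboundary \<psi> a z = \<psi> {} z" using j by (simp add: coboundary_def sgn_pow_def)
        then show ?thesis using j zj by (auto simp: \<psi>_def i_def)
      qed
      then show "z \<in> (\<Union>i\<in>{i\<in>I. p i \<le> p j}. {z\<in>D \<inter> x i \<inter> x j. \<phi> {i} z \<noteq> \<phi> {j} z})"
        using z i zj j by auto
    qed
    then show "eq_fin_on (D \<inter> inter_dom x a) (\<phi> a) (coboundary \<psi> a)"
      unfolding eq_fin_on_def using fin pair by (auto intro: finite_subset)
  qed
qed


section \<open>Short coherent families are trivial\<close>

text \<open>Goblot's vanishing theorem for this system: the induction step removes the maximum of each
  index set, which lowers both the degree and the cardinality of the index set by one.\<close>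

lemma triv_sets_of_card_le:
  fixes I :: "'o::wellorder set" and \<phi> :: "'o set \<Rightarrow> 's \<Rightarrow> 'h::ab_group_add"
  assumes om: "omegas_exist TYPE('o) n" and K: "subgrp K"
    and "|I| \<le>o |omega m :: 'o set|" "coh_sets (Suc m) I D x \<phi>" "\<And>a z. \<phi> a z \<in> K"
  shows "triv_sets K (Suc m) I D x \<phi>"
  using assms(3-)
proof (induction m arbitrary: I D x \<phi>)
  case 0
  have "countable I"
    using 0(1) countable_omega_0[OF om] unfolding card_of_ordLeq[symmetric]
    by (meson countable_image_inj_on countable_subset)
  then show ?case using 0 K by (intro triv_sets_countable) auto
next
  case (Suc m)
  have main: "triv_sets K (Suc (Suc m)) I D x \<phi>"
    if I: "I \<subseteq> omega (Suc m)" and c: "coh_sets (Suc (Suc m)) I D x \<phi>" and \<phi>K: "\<And>a z. \<phi> a z \<in> K"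
    for I :: "'o set" and x and \<phi> :: "'o set \<Rightarrow> 's \<Rightarrow> 'h"
  proof -
    \<comment> \<open>\<open>f \<xi>\<close> has to solve, on the sets with maximum \<xi>, the
      equation that \<open>coboundary_glue\<close> extracts from "\<phi> is almost the coboundary of
      \<open>glue f\<close>". The values \<open>glue f a\<close> for \<open>a\<close> below \<xi>
      are already fixed.\<close>
    define P where "P = (\<lambda>f \<xi> q. (\<forall>a z. q a z \<in> K) \<and> (\<xi> \<in> I \<longrightarrow> (\<forall>a\<in>fsets (Suc m) (I \<inter> {..<\<xi>}).
      eq_fin_on (D \<inter> inter_dom x (insert \<xi> a)) (\<phi> (insert \<xi> a))
        (\<lambda>z. coboundary q a z + sgn_pow (Suc m) (glue f a z)))))"
    have "\<exists>f. \<forall>\<xi>. P f \<xi> (f \<xi>)"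
    proof (rule dependent_wf_choice[OF wf])
      fix f g :: "'o \<Rightarrow> 'o set \<Rightarrow> 's \<Rightarrow> 'h" and \<xi> q
      assume fg: "\<And>\<eta>. (\<eta>, \<xi>) \<in> {(x, y). x < y} \<Longrightarrow> f \<eta> = g \<eta>"
      have "glue f a = glue g a" if "a \<in> fsets (Suc m) (I \<inter> {..<\<xi>})" for a
        by (rule glue_cong[OF that]) (use fg in auto)
      then show "P f \<xi> q = P g \<xi> q" unfolding P_def by simp
    next
      fix \<xi> and f :: "'o \<Rightarrow> 'o set \<Rightarrow> 's \<Rightarrow> 'h"
      assume IH: "\<And>\<eta>. (\<eta>, \<xi>) \<in> {(x, y). x < y} \<Longrightarrow> P f \<eta> (f \<eta>)"
      show "\<exists>q. P f \<xi> q"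
      proof (cases "\<xi> \<in> I")
        case False
        then show ?thesis using subgrp_closed(1)[OF K] by (intro exI[of _ "\<lambda>_ _. 0"]) (simp add: P_def)
      next
        case True
        let ?I = "I \<inter> {..<\<xi>}"
        have below: "eq_fin_on (D \<inter> inter_dom x a) (\<phi> a) (coboundary (glue f) a)"
          if a: "a \<in> fsets (Suc (Suc m)) ?I" for a
        proof -
          define \<eta> where "\<eta> = Max a"
          define b where "b = a - {\<eta>}"
          have \<eta>: "\<eta> \<in> I" "\<eta> < \<xi>" and ab: "a = insert \<eta> b"
            using fsets_remove_Max[OF a] by (auto simp: \<eta>_def b_def)
          have b: "b \<in> fsets (Suc m) (I \<inter> {..<\<eta>})"
            using fsets_remove_Max(2)[OF a] by (auto simp: \<eta>_def b_def fsets_def)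
          have "eq_fin_on (D \<inter> inter_dom x (insert \<eta> b)) (\<phi> (insert \<eta> b))
              (\<lambda>z. coboundary (f \<eta>) b z + sgn_pow (Suc m) (glue f b z))"
            using IH[of \<eta>] \<eta> b by (simp add: P_def)
          moreover have "coboundary (glue f) (insert \<eta> b) z = coboundary (f \<eta>) b z + sgn_pow (Suc m) (glue f b z)" for z
            using b by (subst coboundary_glue) (auto simp: fsets_def)
          ultimately show ?thesis by (simp add: ab eq_fin_on_def)
        qed
        \<comment> \<open>The unknown \<open>q\<close> must trivialize this difference, which is
          coherent since \<phi> is coherent and almost equals the coboundary of
          \<open>glue f\<close> below \<xi>. The default 0 keeps all values in \<open>K\<close>, as
          nothing is known about \<open>glue f\<close> on other sets.\<close>
        define \<theta> where "\<theta> = (\<lambda>a z. \<phi> (insert \<xi> a) z - sgn_pow (Suc m)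
          (if a \<in> fsets (Suc m) ?I then glue f a z else 0))"
        have "triv_sets K (Suc m) ?I (D \<inter> x \<xi>) x \<theta>"
        proof (rule Suc.IH)
          have "|?I| \<le>o |{..<\<xi>}|" by (rule card_of_mono1) simp
          moreover have "|{..<\<xi>}| \<le>o |omega m :: 'o set|" using I True by auto
          ultimately show "|?I| \<le>o |omega m :: 'o set|" by (rule ordLeq_transitive)
          show "\<theta> a z \<in> K" for a z
          proof -
            have "glue f a z \<in> K" if "a \<in> fsets (Suc m) ?I"
              using IH[of "Max a"] fsets_remove_Max(1)[OF that] by (auto simp: P_def glue_def)
            then show ?thesis using \<phi>K subgrp_closed[OF K] by (auto simp: \<theta>_def)
          qed
          show "coh_sets (Suc m) ?I (D \<inter> x \<xi>) x \<theta>" unfolding coh_sets_def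
          proof
            fix b assume b: "b \<in> fsets (Suc (Suc m)) ?I"
            then have fb: "finite b" "\<And>y. y \<in> b \<Longrightarrow> y < \<xi>" "card b = Suc (Suc m)" "b \<subseteq> I"
              by (auto simp: fsets_def)
            have "insert \<xi> b \<in> fsets (Suc (Suc (Suc m))) I"
              by (rule fsets_insert_top[OF b True]) (use fb in auto)
            then have "eq_fin_on (D \<inter> inter_dom x (insert \<xi> b)) (coboundary \<phi> (insert \<xi> b)) (\<lambda>_. 0)"
              using c by (simp add: coh_sets_def)
            then have e1: "\<forall>\<^sub>F z in cofinite. z \<in> D \<inter> inter_dom x (insert \<xi> b) \<longrightarrow> coboundary \<phi> (insert \<xi> b) z = 0"
              by (simp add: eq_fin_on_eventually)
            have e2: "\<forall>\<^sub>F z in cofinite. z \<in> D \<inter> inter_dom x b \<longrightarrow> \<phi> b z = coboundary (glue f) b z"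
              using below[OF b] by (simp add: eq_fin_on_eventually)
            have t: "coboundary \<theta> b z = coboundary (\<lambda>s. \<phi> (insert \<xi> s)) b z - sgn_pow (Suc m) (coboundary (glue f) b z)" for z
            proof -
              have "b - {y} \<in> fsets (Suc m) ?I" if "y \<in> b" for y
                using b that by (auto simp: fsets_def)
              then have "coboundary (\<lambda>a z. sgn_pow (Suc m) (if a \<in> fsets (Suc m) ?I then glue f a z else 0)) b z
                  = coboundary (\<lambda>a z. sgn_pow (Suc m) (glue f a z)) b z"
                by (intro coboundary_cong) simp
              then show ?thesis unfolding \<theta>_def coboundary_diff coboundary_sg by simp
            qed
            show "eq_fin_on (D \<inter> x \<xi> \<inter> inter_dom x b) (coboundary \<theta> b) (\<lambda>_. 0)"
              unfolding eq_fin_on_eventually using e1 e2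
            proof eventually_elim
              case (elim z)
              show ?case
              proof
                assume "z \<in> D \<inter> x \<xi> \<inter> inter_dom x b"
                then have "coboundary \<phi> (insert \<xi> b) z = 0" "\<phi> b z = coboundary (glue f) b z"
                  using elim by (auto simp: inter_dom_def)
                then show "coboundary \<theta> b z = 0"
                  using coboundary_insert_top[of b \<xi> \<phi> z] fb(1-3) unfolding t by (simp add: sgn_pow_Suc)
              qed
            qed
          qed
        qed
        then obtain q where q: "\<And>a z. q a z \<in> K" "\<And>a. a \<in> fsets (Suc m) ?I \<Longrightarrow>
            eq_fin_on (D \<inter> x \<xi> \<inter> inter_dom x a) (\<theta> a) (coboundary q a)"
          unfolding triv_sets_def by blast
        have "P f \<xi> q" unfolding P_def
        proof (intro conjI impI ballI allI q(1))
          fix a assume a: "a \<in> fsets (Suc m) ?I"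
          have X: "D \<inter> inter_dom x (insert \<xi> a) = D \<inter> x \<xi> \<inter> inter_dom x a" by (auto simp: inter_dom_def)
          show "eq_fin_on (D \<inter> inter_dom x (insert \<xi> a)) (\<phi> (insert \<xi> a))
              (\<lambda>z. coboundary q a z + sgn_pow (Suc m) (glue f a z))"
            unfolding X using q(2)[OF a] a
            by (simp add: \<theta>_def eq_fin_on_def diff_eq_eq)
        qed
        then show ?thesis by (intro exI[of _ q])
      qed
    qed
    then obtain f where f: "\<And>\<xi>. P f \<xi> (f \<xi>)" by blast
    show ?thesis unfolding triv_sets_def
    proof (intro exI[of _ "glue f"] conjI allI ballI)
      show "glue f a z \<in> K" for a z using f[of "Max a"] by (simp add: P_def glue_def)
      fix a assume a: "a \<in> fsets (Suc (Suc m)) I"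
      define \<eta> where "\<eta> = Max a"
      define b where "b = a - {\<eta>}"
      have \<eta>: "\<eta> \<in> I" and ab: "a = insert \<eta> b"
        using fsets_remove_Max[OF a] by (auto simp: \<eta>_def b_def)
      have b: "b \<in> fsets (Suc m) (I \<inter> {..<\<eta>})"
        using fsets_remove_Max(2)[OF a] by (auto simp: \<eta>_def b_def)
      have "coboundary (glue f) (insert \<eta> b) z = coboundary (f \<eta>) b z + sgn_pow (Suc m) (glue f b z)" for z
        using b by (subst coboundary_glue) (auto simp: fsets_def)
      then show "eq_fin_on (D \<inter> inter_dom x a) (\<phi> a) (coboundary (glue f) a)"
        using f[of \<eta>] \<eta> b by (simp add: P_def ab eq_fin_on_def)
    qed
  qed
  \<comment> \<open>After this reindexing every proper initial segment has size at most omega_m, as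
    the induction hypothesis requires. The injection need not preserve the order; the
    \<open>swaps\<close> signs account for that.\<close>
  obtain f :: "'o \<Rightarrow> 'o" where f: "inj_on f I" "f ` I \<subseteq> omega (Suc m)"
    using Suc.prems(1) unfolding card_of_ordLeq[symmetric] by blast
  define J where "J = f ` I"
  define g where "g = inv_into I f"
  have g: "inj_on g J" "g ` J = I" using f(1) by (auto simp: g_def J_def inj_on_inv_into)
  have "triv_sets K (Suc (Suc m)) J D (x \<circ> g) (\<lambda>a z. sgn_pow (swaps g a) (\<phi> (g ` a) z))"
  proof (rule main)
    show "J \<subseteq> omega (Suc m)" using f by (simp add: J_def)
    show "coh_sets (Suc (Suc m)) J D (x \<circ> g) (\<lambda>a z. sgn_pow (swaps g a) (\<phi> (g ` a) z))"
      by (rule coh_sets_reindex[OF g(1)]) (use Suc.prems g in simp)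
  qed (use Suc.prems(3) subgrp_closed[OF K] in auto)
  then show ?case using triv_sets_reindex[OF g(1) K] g(2) by metis
qed

section \<open>Nontrivial families\<close>

text \<open>\<open>E A\<close> plays the role of the union of the \<open>e\<^sub>w\<close> with \<open>w\<close> in \<open>Fn\<^sup>+(A)\<close>.  Unlike the original
  definition, this one is inherited by the sequences \<open>x\<^sub>\<alpha> \<inter> x\<^sub>\<beta>\<close>, \<open>\<alpha> < \<beta>\<close>, reindexed in type
  \<open>\<omega>\<^sub>n\<close> when \<open>\<beta>\<close> has cofinality \<open>\<omega>\<^sub>n\<close>.\<close>

definition ascending_op :: "nat \<Rightarrow> ('o::wellorder \<Rightarrow> 's set) \<Rightarrow> 's set \<Rightarrow> ('o set \<Rightarrow> 's set) \<Rightarrow> 'o set \<Rightarrow> bool" where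
  "ascending_op n x D E C \<longleftrightarrow> club (omega n) C \<and> mono E \<and> (\<forall>A. E A \<subseteq> D) \<and>
     (\<forall>A. \<forall>z\<in>E A. \<exists>F. finite F \<and> F \<subseteq> A \<and> z \<in> E F) \<and>
     (\<forall>A (B :: 'o set). infinite B \<and> |A| \<le>o |B| \<longrightarrow> |E A| \<le>o |B| ) \<and>
     (\<forall>\<gamma>\<in>C. \<forall>F a. finite F \<and> F \<subseteq> {..<\<gamma>} \<and> finite a \<and> a \<subseteq> C \<inter> {\<gamma><..} \<longrightarrow>
        infinite (E (insert \<gamma> F) \<inter> x \<gamma> \<inter> inter_dom x a - \<Union> (x ` F)))"

lemma ascending_opD:
  fixes x :: "'o::wellorder \<Rightarrow> 's set" and B :: "'o set"
  assumes "ascending_op n x D E C"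
  shows "club (omega n) C" "mono E" "E A \<subseteq> D" "z \<in> E A \<Longrightarrow> \<exists>F. finite F \<and> F \<subseteq> A \<and> z \<in> E F"
    "infinite B \<Longrightarrow> |A| \<le>o |B| \<Longrightarrow> |E A| \<le>o |B|"
    "\<gamma> \<in> C \<Longrightarrow> finite F \<Longrightarrow> F \<subseteq> {..<\<gamma>} \<Longrightarrow> finite a \<Longrightarrow> a \<subseteq> C \<inter> {\<gamma><..} \<Longrightarrow>
      infinite (E (insert \<gamma> F) \<inter> x \<gamma> \<inter> inter_dom x a - \<Union> (x ` F))"
  using assms by (simp_all add: ascending_op_def)

text \<open>For n = 0 the relevant index set is empty and \<open>Max a\<close> is meaningless, so
  support in \<open>E\<close> is demanded only in positive degree.\<close>

definition has_nontriv :: "nat \<Rightarrow> 'h::ab_group_add set \<Rightarrow> ('o::wellorder \<Rightarrow> 's set) \<Rightarrow> 's set \<Rightarrow>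
    ('o set \<Rightarrow> 's set) \<Rightarrow> bool" where
  "has_nontriv n K x D E \<longleftrightarrow> (\<exists>\<phi>. (\<forall>a z. \<phi> a z \<in> K) \<and>
     (\<forall>a z. \<phi> a z \<noteq> 0 \<longrightarrow> z \<in> D \<and> (n \<noteq> 0 \<longrightarrow> z \<in> E {..<Max a})) \<and>
     coh_sets n (omega n) D x \<phi> \<and> \<not> triv_sets K n (omega n) D x \<phi>)"

text \<open>An index \<gamma> in \<open>C\<close> has only finitely many predecessors, so
  \<open>x \<gamma>\<close> contains a point \<open>p \<gamma>\<close> lying in no earlier set. Each
  \<open>x i\<close> then contains \<open>p \<gamma>\<close> only for \<gamma> \<le> i, finitely
  often, while all these points together form an infinite set.\<close>

lemma has_nontriv_0:
  fixes x :: "'o::wellorder \<Rightarrow> 's set" and K :: "'h::ab_group_add set"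
  assumes om: "omegas_exist TYPE('o) n" and a: "ascending_op 0 x D E C" and K: "subgrp K" and h: "h \<in> K" "h \<noteq> 0"
  shows "has_nontriv 0 K x D E"
proof -
  have C: "C \<subseteq> omega 0" "\<And>\<xi>. \<xi> \<in> omega 0 \<Longrightarrow> \<exists>\<gamma>\<in>C. \<xi> \<le> \<gamma>"
    using ascending_opD(1)[OF a] by (simp_all add: club_def)
  have fin: "finite {..i}" if "i \<in> omega 0" for i :: 'o
  proof -
    have "{..i} = insert i {..<i}" by auto
    then show ?thesis using that by simp
  qed
  have infC: "infinite C"
  proof
    assume "finite C"
    moreover have "omega 0 \<subseteq> (\<Union>\<gamma>\<in>C. {..\<gamma>})" using C(2) by blast
    ultimately have "finite (omega 0 :: 'o set)"
      using fin C(1) by (meson finite_UN finite_subset subsetD)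
    then show False using omega_infinite[OF om, of 0] by simp
  qed
  have "\<exists>z. z \<in> D \<inter> x \<gamma> - \<Union> (x ` {..<\<gamma>})" if \<gamma>: "\<gamma> \<in> C" for \<gamma>
  proof -
    have "finite {..<\<gamma>}" using \<gamma> C(1) by auto
    then have "infinite (E (insert \<gamma> {..<\<gamma>}) \<inter> x \<gamma> \<inter> inter_dom x {} - \<Union> (x ` {..<\<gamma>}))"
      by (intro ascending_opD(6)[OF a]) (use \<gamma> in auto)
    then have "E (insert \<gamma> {..<\<gamma>}) \<inter> x \<gamma> \<inter> inter_dom x {} - \<Union> (x ` {..<\<gamma>}) \<noteq> {}"
      by (metis finite.emptyI)
    then show ?thesis using ascending_opD(3)[OF a] by blast
  qed
  then obtain p where p: "\<And>\<gamma>. \<gamma> \<in> C \<Longrightarrow> p \<gamma> \<in> D \<and> p \<gamma> \<in> x \<gamma> \<and> p \<gamma> \<notin> \<Union> (x ` {..<\<gamma>})"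
    by (metis DiffD1 DiffD2 IntD1 IntD2)
  have inj: "inj_on p C"
  proof (rule linorder_inj_onI)
    fix i j assume "i < j" "i \<in> C" "j \<in> C"
    then show "p i \<noteq> p j" using p[of i] p[of j] by auto
  qed auto
  define \<phi> where "\<phi> = (\<lambda>(b::'o set) z. if z \<in> p ` C then h else 0)"
  show ?thesis unfolding has_nontriv_def
  proof (intro exI[of _ \<phi>] conjI allI impI)
    show "\<phi> b z \<in> K" for b z using h subgrp_closed(1)[OF K] by (simp add: \<phi>_def)
    show "\<phi> b z \<noteq> 0 \<Longrightarrow> z \<in> D" for b z using p by (auto simp: \<phi>_def split: if_splits)
    show "coh_sets 0 (omega 0) D x \<phi>" unfolding coh_sets_def
    proof
      fix b assume "b \<in> fsets (Suc 0) (omega 0 :: 'o set)"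
      then obtain i where i: "b = {i}" "i \<in> omega 0" by (auto simp: fsets_def card_1_singleton_iff)
      have "{z \<in> D \<inter> inter_dom x b. coboundary \<phi> b z \<noteq> 0} \<subseteq> p ` {..i}"
      proof
        fix z assume z: "z \<in> {z \<in> D \<inter> inter_dom x b. coboundary \<phi> b z \<noteq> 0}"
        then have "\<phi> {} z \<noteq> 0" using i by (auto simp: coboundary_def)
        then obtain \<gamma> where \<gamma>: "\<gamma> \<in> C" "z = p \<gamma>" by (auto simp: \<phi>_def split: if_splits)
        moreover have "z \<in> x i" using z i by (simp add: inter_dom_def)
        ultimately have "\<not> i < \<gamma>" using p[OF \<gamma>(1)] by auto
        then show "z \<in> p ` {..i}" using \<gamma> by auto
      qed
      then show "eq_fin_on (D \<inter> inter_dom x b) (coboundary \<phi> b) (\<lambda>_. 0)"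
        unfolding eq_fin_on_def using fin[OF i(2)] by (meson finite_imageI finite_subset)
    qed
    show "\<not> triv_sets K 0 (omega 0) D x \<phi>"
    proof
      assume "triv_sets K 0 (omega 0) D x \<phi>"
      then have "eq_fin_on D (\<phi> {}) (\<lambda>_. 0)"
        by (auto simp: triv_sets_def fsets_def inter_dom_def eq_fin_on_def)
      then have "finite {z\<in>D. \<phi> {} z \<noteq> 0}" by (simp add: eq_fin_on_def)
      moreover have "{z\<in>D. \<phi> {} z \<noteq> 0} = p ` C" using p h by (auto simp: \<phi>_def)
      ultimately show False using infC finite_imageD[OF _ inj] by auto
    qed
  qed simp
qed


section \<open>Initial segments of cofinality omega_n\<close>

lemma card_lessThan_omega:
  assumes "omegas_exist TYPE('o::wellorder) N" "k \<le> N" "\<xi> \<in> omega k"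
  shows "|{..<\<xi>::'o}| <o |omega k :: 'o set|"
proof (cases k)
  case 0
  then have "\<not> |omega k :: 'o set| \<le>o |{..<\<xi>}|"
    using assms(3) omega_infinite[OF assms(1,2)] card_of_ordLeq_finite by auto
  then show ?thesis using not_ordLeq_iff_ordLess[OF card_of_Well_order card_of_Well_order] by blast
next
  case (Suc j)
  then have "|{..<\<xi>}| \<le>o |omega j :: 'o set|" using assms(3) by simp
  then show ?thesis using omega_Suc_less[OF assms(1), of j] assms(2) Suc ordLeq_ordLess_trans by auto
qed

text \<open>The bijection starts from an arbitrary one and, for each \<open>j\<close> in a greedily chosen club,
  exchanges \<open>j\<close> with a later index whose value lies in \<open>C\<close> above all values at indices below
  \<open>j\<close>.\<close>

lemma exists_reordering:
  fixes \<beta> :: "'o::wellorder"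
  assumes om: "omegas_exist TYPE('o) N" and n: "n \<le> N" and \<beta>: "\<beta> \<in> S_cof n"
    and lim: "\<And>\<xi>. \<xi> < \<beta> \<Longrightarrow> \<exists>\<gamma>\<in>C. \<xi> < \<gamma> \<and> \<gamma> < \<beta>"
  shows "\<exists>(\<pi> :: 'o \<Rightarrow> 'o) C'. bij_betw \<pi> (omega n) {..<\<beta>} \<and> club (omega n) C' \<and>
    (\<forall>j\<in>C'. \<pi> j \<in> C \<and> (\<forall>i<j. \<pi> i < \<pi> j))"
proof -
  let ?O = "omega n :: 'o set"
  have cof: "\<And>A. cofinal_in \<beta> A \<Longrightarrow> |?O| \<le>o |A|" and le: "|{..<\<beta>}| \<le>o |?O|"
    using \<beta> by (auto simp: S_cof_def has_cof_def)
  obtain A where "cofinal_in \<beta> A" "|A| =o |?O|"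
    using \<beta> by (auto simp: S_cof_def has_cof_def)
  then have "|?O| \<le>o |{..<\<beta>}|"
    using cof card_of_mono1[of A "{..<\<beta>}"] ordLeq_transitive unfolding cofinal_in_def by blast
  then have "|?O| =o |{..<\<beta>}|" using le by (simp add: ordIso_iff_ordLeq)
  then obtain \<sigma> where \<sigma>: "bij_betw \<sigma> ?O {..<\<beta>}"
    unfolding card_of_ordIso[symmetric] by blast
  \<comment> \<open>The values of \<sigma> below \<open>j\<close> number fewer than omega_n, so they
    are bounded in \<beta> by its cofinality, and \<beta> is a limit of \<open>C\<close>.\<close>
  have "\<forall>j\<in>?O. \<exists>k\<in>?O. \<sigma> k \<in> C \<and> (\<forall>i<j. \<sigma> i < \<sigma> k)"
  proof
    fix j assume j: "j \<in> ?O"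
    have "|\<sigma> ` {..<j}| <o |?O|"
      using card_of_image card_lessThan_omega[OF om n j] by (rule ordLeq_ordLess_trans)
    then have "\<not> cofinal_in \<beta> (\<sigma> ` {..<j})"
      using cof not_ordLess_ordLeq by blast
    moreover have "\<sigma> ` {..<j} \<subseteq> {..<\<beta>}"
      using lessThan_subset_omega[OF j] \<sigma> by (auto simp: bij_betw_def)
    ultimately obtain \<xi> where \<xi>: "\<xi> < \<beta>" "\<And>i. i < j \<Longrightarrow> \<sigma> i < \<xi>"
      by (fastforce simp: cofinal_in_def not_le)
    then obtain \<gamma> where \<gamma>: "\<gamma> \<in> C" "\<xi> < \<gamma>" "\<gamma> < \<beta>" using lim by blast
    then have "\<gamma> \<in> \<sigma> ` ?O" using \<sigma> by (simp add: bij_betw_def)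
    then obtain k where "k \<in> ?O" "\<sigma> k = \<gamma>" by blast
    then show "\<exists>k\<in>?O. \<sigma> k \<in> C \<and> (\<forall>i<j. \<sigma> i < \<sigma> k)"
      using \<gamma> \<xi> by (intro bexI[of _ k]) (auto intro: less_trans)
  qed
  then obtain nxt where nxt: "\<And>j. j \<in> ?O \<Longrightarrow> nxt j \<in> ?O \<and> \<sigma> (nxt j) \<in> C \<and> (\<forall>i<j. \<sigma> i < \<sigma> (nxt j))"
    by metis
  have nxt_ge: "j \<le> nxt j" if "j \<in> ?O" for j
    using nxt[OF that] by (meson less_irrefl not_less)
  \<comment> \<open>Membership in \<open>C'\<close> is decided recursively: \<open>j\<close> is
    taken when it exceeds \<open>nxt i\<close> for all earlier members \<open>i\<close>. This makes
    the intervals from \<open>i\<close> to \<open>nxt i\<close> pairwise disjoint.\<close>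
  define c where "c = wfrec {(i, j). i < j} (\<lambda>f j. \<forall>i<j. f i \<longrightarrow> nxt i < j)"
  have c: "c j \<longleftrightarrow> (\<forall>i<j. c i \<longrightarrow> nxt i < j)" for j
    unfolding c_def by (subst wfrec[OF wf]) (simp add: cut_def)
  define C' where "C' = {j \<in> ?O. c j}"
  have C': "nxt i < j" if "i \<in> C'" "j \<in> C'" "i < j" for i j
    using that c[of j] by (auto simp: C'_def)
  have C'I: "j \<in> C'" if "j \<in> ?O" "\<And>i. i \<in> C' \<Longrightarrow> i < j \<Longrightarrow> nxt i < j" for j
  proof -
    have "\<And>i. i < j \<Longrightarrow> c i \<Longrightarrow> nxt i < j"
      using that omega_downward[OF that(1)] unfolding C'_def by (simp add: less_imp_le)
    then show ?thesis using that(1) c[of j] by (simp add: C'_def)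
  qed
  have C'O: "C' \<subseteq> ?O" by (auto simp: C'_def)
  have club: "club ?O C'" unfolding club_def
  proof (intro conjI ballI impI C'O)
    fix \<alpha> assume \<alpha>: "\<alpha> \<in> ?O" "{..<\<alpha>} \<noteq> {} \<and> (\<forall>\<xi><\<alpha>. \<exists>\<gamma>\<in>C'. \<xi> < \<gamma> \<and> \<gamma> < \<alpha>)"
    show "\<alpha> \<in> C'"
    proof (rule C'I[OF \<alpha>(1)])
      fix i assume "i \<in> C'" "i < \<alpha>"
      moreover obtain \<gamma> where "\<gamma> \<in> C'" "i < \<gamma>" "\<gamma> < \<alpha>" using \<alpha>(2) \<open>i < \<alpha>\<close> by blast
      ultimately show "nxt i < \<alpha>" using C' less_trans by blast
    qed
  next
    fix \<xi> assume \<xi>: "\<xi> \<in> ?O"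
    have "nxt ` {..<\<xi>} \<subseteq> ?O" using nxt lessThan_subset_omega[OF \<xi>] by blast
    then obtain \<eta> where \<eta>: "\<eta> \<in> ?O" "nxt ` {..<\<xi>} \<subseteq> {..<\<eta>}"
      using omega_bounded_image[OF om n \<xi>] by blast
    \<comment> \<open>The least such \<open>j\<close> belongs to \<open>C'\<close>: a member of
      \<open>C'\<close> from \<xi> up to below \<open>j\<close> would itself satisfy
      \<open>Q\<close>, so only members below \<xi> have to be checked.\<close>
    define Q where "Q = (\<lambda>j. \<xi> \<le> j \<and> (\<forall>i<\<xi>. i \<in> C' \<longrightarrow> nxt i < j))"
    have Qm: "Q (max \<xi> \<eta>)" using \<eta> by (auto simp: Q_def less_max_iff_disj)
    define j where "j = (LEAST j. Q j)"
    have Qj: "Q j" unfolding j_def using Qm by (rule LeastI)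
    have "j \<le> max \<xi> \<eta>" unfolding j_def using Qm by (rule Least_le)
    then have jO: "j \<in> ?O" using \<xi> \<eta>(1) omega_downward by (metis max_def)
    have "j \<in> C'"
    proof (rule C'I[OF jO])
      fix i assume i: "i \<in> C'" "i < j"
      have "i < \<xi>"
      proof (rule ccontr)
        assume "\<not> i < \<xi>"
        then have "Q i" unfolding Q_def using C' i(1) by auto
        then show False using not_less_Least[of i Q] i(2) by (simp add: j_def)
      qed
      then show "nxt i < j" using Qj i(1) by (simp add: Q_def)
    qed
    then show "\<exists>\<gamma>\<in>C'. \<xi> \<le> \<gamma>" using Qj by (auto simp: Q_def)
  qed
  have inj: "inj_on nxt C'"
  proof (rule linorder_inj_onI)
    fix i j assume "i < j" "i \<in> C'" "j \<in> C'"
    then show "nxt i \<noteq> nxt j" using C'[of i j] nxt_ge[of j] C'O by force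
  qed auto
  \<comment> \<open>Disjointness of the intervals makes this an involution on
    \<open>omega n\<close>. An index below some \<open>j\<close> in \<open>C'\<close> moves only
    within an interval that ends before \<open>j\<close>.\<close>
  define \<tau> where "\<tau> = (\<lambda>j. if j \<in> C' then nxt j else if j \<in> nxt ` C' then inv_into C' nxt j else j)"
  have \<tau>O: "\<tau> j \<in> ?O" if "j \<in> ?O" for j
    using that nxt[OF that] C'O inv_into_into[of j nxt C'] by (auto simp: \<tau>_def)
  have \<tau>\<tau>: "\<tau> (\<tau> j) = j" if "j \<in> ?O" for j
  proof (cases "j \<in> C'")
    case True
    show ?thesis
    proof (cases "nxt j = j")
      case False
      then have "j < nxt j" using nxt_ge[OF that] by simp
      then have "nxt j \<notin> C'" using C'[OF True, of "nxt j"] by auto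
      then show ?thesis using True inv_into_f_f[OF inj True] by (simp add: \<tau>_def)
    qed (use True in \<open>simp add: \<tau>_def\<close>)
  next
    case False
    then show ?thesis
      using inv_into_into[of j nxt C'] f_inv_into_f[of j nxt C'] by (simp add: \<tau>_def)
  qed
  have \<tau>b: "bij_betw \<tau> ?O ?O"
    by (rule bij_betw_byWitness[of _ \<tau>]) (use \<tau>O \<tau>\<tau> in auto)
  have \<tau>less: "\<tau> i < j" if "j \<in> C'" "i < j" for i j
  proof (cases "i \<in> C'")
    case False
    show ?thesis
    proof (cases "i \<in> nxt ` C'")
      case True
      then obtain k where k: "k \<in> C'" "i = nxt k" by blast
      then have "\<tau> i = k" using False inv_into_f_f[OF inj k(1)] by (simp add: \<tau>_def)
      then show ?thesis using k nxt_ge[of k] C'O that(2) by auto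
    qed (use False that in \<open>simp add: \<tau>_def\<close>)
  qed (use C' that in \<open>simp add: \<tau>_def\<close>)
  show ?thesis
  proof (intro exI[of _ "\<sigma> \<circ> \<tau>"] exI[of _ C'] conjI ballI club allI impI)
    show "bij_betw (\<sigma> \<circ> \<tau>) ?O {..<\<beta>}" using \<tau>b \<sigma> by (rule bij_betw_trans)
    fix j assume j: "j \<in> C'"
    show "(\<sigma> \<circ> \<tau>) j \<in> C" using j nxt C'O by (auto simp: \<tau>_def)
    fix i assume "i < j"
    then have "\<tau> i < j" using \<tau>less[OF j] by blast
    then show "(\<sigma> \<circ> \<tau>) i < (\<sigma> \<circ> \<tau>) j" using nxt[of j] j C'O by (auto simp: \<tau>_def)
  qed
qed

text \<open>The reordered sequence inside \<open>x \<beta>\<close> is again ascending because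
  \<beta> lies in \<open>C\<close>: in the last clause of \<open>ascending_op\<close>, \<beta> joins
  the finite set \<open>a\<close> of later indices, which supplies the intersection with
  \<open>x \<beta>\<close>. The resulting family is carried back along the inverse of \<pi>.\<close>

lemma nontriv_below:
  fixes x :: "'o::wellorder \<Rightarrow> 's set" and K :: "'h::ab_group_add set"
  assumes om: "omegas_exist TYPE('o) N" and n: "n \<le> N" and K: "subgrp K"
    and a: "ascending_op (Suc n) x D E C" and \<beta>: "\<beta> \<in> S_cof n" "\<beta> \<in> C"
    and lim: "\<And>\<xi>. \<xi> < \<beta> \<Longrightarrow> \<exists>\<gamma>\<in>C. \<xi> < \<gamma> \<and> \<gamma> < \<beta>"
    and NT: "\<And>(x :: 'o \<Rightarrow> 's set) D E C. ascending_op n x D E C \<Longrightarrow> has_nontriv n K x D E"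
  shows "\<exists>\<theta>. (\<forall>a z. \<theta> a z \<in> K \<and> (\<theta> a z \<noteq> 0 \<longrightarrow> z \<in> E {..<\<beta>} \<inter> x \<beta>)) \<and>
    coh_sets n {..<\<beta>} (E {..<\<beta>} \<inter> x \<beta>) x \<theta> \<and> \<not> triv_sets K n {..<\<beta>} (E {..<\<beta>} \<inter> x \<beta>) x \<theta>"
proof -
  obtain \<pi> :: "'o \<Rightarrow> 'o" and C' where \<pi>: "bij_betw \<pi> (omega n) {..<\<beta>}" and C': "club (omega n) C'"
    and \<pi>C: "\<And>j. j \<in> C' \<Longrightarrow> \<pi> j \<in> C" "\<And>i j. j \<in> C' \<Longrightarrow> i < j \<Longrightarrow> \<pi> i < \<pi> j"
    using exists_reordering[OF om n \<beta>(1) lim] by blast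
  have C'O: "C' \<subseteq> omega n" using C' by (simp add: club_def)
  have \<pi>\<beta>: "\<pi> j < \<beta>" if "j \<in> omega n" for j using \<pi> that by (auto simp: bij_betw_def)
  define D' where "D' = E {..<\<beta>} \<inter> x \<beta>"
  \<comment> \<open>The clauses of \<open>ascending_op\<close> concern arbitrary \<open>A\<close>,
    but \<pi> is controlled only on \<open>omega n\<close>; intersecting with
    \<open>{..<\<beta>}\<close> discards stray values.\<close>
  define E' where "E' = (\<lambda>A. E (\<pi> ` A \<inter> {..<\<beta>}) \<inter> x \<beta>)"
  have mono: "E A \<subseteq> E B" if "A \<subseteq> B" for A B using ascending_opD(2)[OF a] that by (rule monoD)
  have "ascending_op n (x \<circ> \<pi>) D' E' C'" unfolding ascending_op_def
  proof (intro conjI allI ballI impI C')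
    show "mono E'"
    proof (rule monoI)
      fix A B :: "'o set" assume "A \<subseteq> B"
      then have "E (\<pi> ` A \<inter> {..<\<beta>}) \<subseteq> E (\<pi> ` B \<inter> {..<\<beta>})" by (intro mono) auto
      then show "E' A \<subseteq> E' B" by (auto simp: E'_def)
    qed
    show "E' A \<subseteq> D'" for A using mono[of "\<pi> ` A \<inter> {..<\<beta>}" "{..<\<beta>}"] by (auto simp: E'_def D'_def)
    show "\<exists>F. finite F \<and> F \<subseteq> A \<and> z \<in> E' F" if z: "z \<in> E' A" for A z
    proof -
      obtain F where F: "finite F" "F \<subseteq> \<pi> ` A \<inter> {..<\<beta>}" "z \<in> E F"
        using ascending_opD(4)[OF a, of z "\<pi> ` A \<inter> {..<\<beta>}"] z by (auto simp: E'_def)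
      then obtain G where "finite G" "G \<subseteq> A" "F = \<pi> ` G"
        using finite_subset_image[of F \<pi> A] by auto
      then show ?thesis using F z by (intro exI[of _ G]) (auto simp: E'_def Int_absorb2)
    qed
    show "|E' A| \<le>o |B|" if B: "infinite B \<and> |A| \<le>o |B|" for A B :: "'o set"
    proof -
      have "|\<pi> ` A \<inter> {..<\<beta>}| \<le>o |\<pi> ` A|" by (rule card_of_mono1) auto
      then have "|\<pi> ` A \<inter> {..<\<beta>}| \<le>o |B|"
        using B card_of_image[of \<pi> A] ordLeq_transitive by blast
      then have "|E (\<pi> ` A \<inter> {..<\<beta>})| \<le>o |B|" using ascending_opD(5)[OF a] B by blast
      then show ?thesis using card_of_mono1[of "E' A" "E (\<pi> ` A \<inter> {..<\<beta>})"] ordLeq_transitive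
        by (auto simp: E'_def)
    qed
    fix \<gamma> F b assume \<gamma>: "\<gamma> \<in> C'"
      and h: "finite F \<and> F \<subseteq> {..<\<gamma>} \<and> finite b \<and> b \<subseteq> C' \<inter> {\<gamma><..}"
    have \<gamma>O: "\<gamma> \<in> omega n" using \<gamma> C'O by blast
    have FO: "F \<subseteq> omega n" using h lessThan_subset_omega[OF \<gamma>O] by blast
    have inf: "infinite (E (insert (\<pi> \<gamma>) (\<pi> ` F)) \<inter> x (\<pi> \<gamma>) \<inter> inter_dom x (insert \<beta> (\<pi> ` b)) - \<Union> (x ` \<pi> ` F))"
    proof (rule ascending_opD(6)[OF a \<pi>C(1)[OF \<gamma>]])
      show "insert \<beta> (\<pi> ` b) \<subseteq> C \<inter> {\<pi> \<gamma><..}"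
      proof -
        have "\<pi> i \<in> C \<and> \<pi> \<gamma> < \<pi> i" if "i \<in> b" for i
          using \<pi>C(1)[of i] \<pi>C(2)[of i \<gamma>] h that by blast
        then show ?thesis using \<beta>(2) \<pi>\<beta>[OF \<gamma>O] by auto
      qed
    qed (use h \<pi>C(2)[OF \<gamma>] in auto)
    have e1: "insert (\<pi> \<gamma>) (\<pi> ` F) = \<pi> ` insert \<gamma> F \<inter> {..<\<beta>}"
    proof -
      have "\<pi> ` insert \<gamma> F \<subseteq> {..<\<beta>}" using \<pi>\<beta> \<gamma>O FO by blast
      then show ?thesis by (metis Int_absorb2 image_insert)
    qed
    have e2: "inter_dom x (insert \<beta> (\<pi> ` b)) = x \<beta> \<inter> inter_dom (x \<circ> \<pi>) b" by (auto simp: inter_dom_def)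
    have "infinite (E (\<pi> ` insert \<gamma> F \<inter> {..<\<beta>}) \<inter> x (\<pi> \<gamma>) \<inter> (x \<beta> \<inter> inter_dom (x \<circ> \<pi>) b)
        - \<Union> (x ` \<pi> ` F))"
      using inf unfolding e1 e2 .
    moreover have "E' (insert \<gamma> F) \<inter> (x \<circ> \<pi>) \<gamma> \<inter> inter_dom (x \<circ> \<pi>) b - \<Union> ((x \<circ> \<pi>) ` F) =
        E (\<pi> ` insert \<gamma> F \<inter> {..<\<beta>}) \<inter> x (\<pi> \<gamma>) \<inter> (x \<beta> \<inter> inter_dom (x \<circ> \<pi>) b) - \<Union> (x ` \<pi> ` F)"
      unfolding E'_def comp_def image_image by blast
    ultimately show "infinite (E' (insert \<gamma> F) \<inter> (x \<circ> \<pi>) \<gamma> \<inter> inter_dom (x \<circ> \<pi>) b - \<Union> ((x \<circ> \<pi>) ` F))"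
      by metis
  qed
  then have "has_nontriv n K (x \<circ> \<pi>) D' E'" by (rule NT)
  then obtain \<phi> where \<phi>: "\<And>a z. \<phi> a z \<in> K" "\<And>a z. \<phi> a z \<noteq> 0 \<Longrightarrow> z \<in> D'"
    "coh_sets n (omega n) D' (x \<circ> \<pi>) \<phi>" "\<not> triv_sets K n (omega n) D' (x \<circ> \<pi>) \<phi>"
    unfolding has_nontriv_def by blast
  define f where "f = inv_into (omega n) \<pi>"
  have f: "inj_on f {..<\<beta>}" "f ` {..<\<beta>} = omega n"
    using bij_betw_inv_into[OF \<pi>] by (auto simp: f_def bij_betw_def)
  have \<pi>f: "((x \<circ> \<pi>) \<circ> f) i = x i" if "i \<in> {..<\<beta>}" for i
    using f_inv_into_f[of i \<pi> "omega n"] \<pi> that by (simp add: f_def bij_betw_def)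
  define \<theta> where "\<theta> = (\<lambda>a z. sgn_pow (swaps f a) (\<phi> (f ` a) z))"
  show ?thesis
  proof (intro exI[of _ \<theta>] conjI allI impI; (fold D'_def)?)
    show "\<theta> a z \<in> K" "\<theta> a z \<noteq> 0 \<Longrightarrow> z \<in> D'" for a z
      using \<phi>(1,2) subgrp_closed(5)[OF K] by (auto simp: \<theta>_def)
    have "coh_sets n {..<\<beta>} D' ((x \<circ> \<pi>) \<circ> f) \<theta>"
      unfolding \<theta>_def using coh_sets_reindex[OF f(1), of n D' "x \<circ> \<pi>" \<phi>, unfolded f(2), OF \<phi>(3)] .
    then show "coh_sets n {..<\<beta>} D' x \<theta>" by (subst (asm) coh_sets_cong_x[OF \<pi>f])
    show "\<not> triv_sets K n {..<\<beta>} D' x \<theta>"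
    proof
      assume "triv_sets K n {..<\<beta>} D' x \<theta>"
      then have "triv_sets K n {..<\<beta>} D' ((x \<circ> \<pi>) \<circ> f) \<theta>" by (subst triv_sets_cong_x[OF \<pi>f])
      then have "triv_sets K n {..<\<beta>} D' ((x \<circ> \<pi>) \<circ> f) (\<lambda>a z. sgn_pow (swaps f a) (\<phi> (f ` a) z))"
        unfolding \<theta>_def .
      then have "triv_sets K n (f ` {..<\<beta>}) D' (x \<circ> \<pi>) \<phi>"
        by (rule triv_sets_reindex[OF f(1) K, of n D' "x \<circ> \<pi>" \<phi>])
      then show False using \<phi>(4) unfolding f(2) by contradiction
    qed
  qed
qed


section \<open>The successor step by weak diamond\<close>

lemma coh_sets_mono: "coh_sets n I D x \<phi> \<Longrightarrow> D' \<subseteq> D \<Longrightarrow> coh_sets n I D' x \<phi>"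
  unfolding coh_sets_def eq_fin_on_def by (fastforce elim: rev_finite_subset)

lemma triv_sets_cong:
  assumes "\<And>a z. a \<in> fsets n I \<Longrightarrow> z \<in> D \<Longrightarrow> \<phi> a z = \<phi>' a z"
  shows "triv_sets K n I D x \<phi> \<longleftrightarrow> triv_sets K n I D x \<phi>'"
proof -
  have "eq_fin_on (D \<inter> inter_dom x a) (\<phi> a) h \<longleftrightarrow> eq_fin_on (D \<inter> inter_dom x a) (\<phi>' a) h" if "a \<in> fsets n I" for a h
    unfolding eq_fin_on_def using assms[OF that] by (intro arg_cong[of _ _ finite]) auto
  then show ?thesis by (simp add: triv_sets_def cong: conj_cong)
qed

lemma card_atMost_omega:
  assumes "omegas_exist TYPE('o::wellorder) N" "Suc k \<le> N" "\<xi> \<in> omega (Suc k)"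
  shows "|{..\<xi>::'o}| \<le>o |omega k :: 'o set|"
proof -
  have inf: "infinite (omega k :: 'o set)" using assms(2) by (intro omega_infinite[OF assms(1)]) simp
  have "|{\<xi>}| \<le>o |omega k :: 'o set|" using inf by (intro countable_ordLeq_infinite) auto
  then have "|{..<\<xi>} \<union> {\<xi>}| \<le>o |omega k :: 'o set|"
    using assms(3) inf by (intro card_of_Un_infinite) auto
  moreover have "{..<\<xi>} \<union> {\<xi>} = {..\<xi>}" by auto
  ultimately show ?thesis by simp
qed

lemma has_nontriv_Suc:
  fixes x :: "'o::wellorder \<Rightarrow> 's set" and K :: "'h::ab_group_add set"
  assumes om: "omegas_exist TYPE('o) N" and n: "Suc n \<le> N" and K: "subgrp K"
    and cK: "|K| \<le>o |Pow (omega n :: 'o set)|"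
    and wd: "weak_diamond (omega (Suc n) :: 'o set) (S_cof n)"
    and NT: "\<And>(x :: 'o \<Rightarrow> 's set) D E C. ascending_op n x D E C \<Longrightarrow> has_nontriv n K x D E"
    and a: "ascending_op (Suc n) x D E C"
  shows "has_nontriv (Suc n) K x D E"
proof -
  let ?O = "omega (Suc n) :: 'o set"
  note [simp del] = omega.simps
  note sub = subgrp_closed[OF K]
  define D' where "D' = (\<lambda>\<beta>. E {..<\<beta>} \<inter> x \<beta>)"
  define vals where "vals = (\<lambda>\<beta> (q :: 'o set \<Rightarrow> 's \<Rightarrow> 'h). \<forall>a z. q a z \<in> K \<and> (q a z \<noteq> 0 \<longrightarrow> z \<in> D' \<beta>))"
  define lim where "lim = (\<lambda>\<beta>. \<beta> \<in> C \<and> (\<forall>\<xi><\<beta>. \<exists>\<gamma>\<in>C. \<xi> < \<gamma> \<and> \<gamma> < \<beta>))"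
  have mono: "E A \<subseteq> E B" if "A \<subseteq> B" for A B using ascending_opD(2)[OF a] that by (rule monoD)
  have D'D: "D' \<beta> \<subseteq> D" for \<beta> using ascending_opD(3)[OF a] by (auto simp: D'_def)

  \<comment> \<open>\<theta> is the difference of the two extensions offered at \<beta>. In the
    remaining cases it is 0 and the two extensions simply coincide.\<close>
  have "\<exists>\<theta>. vals \<beta> \<theta> \<and> coh_sets n {..<\<beta>} (D' \<beta>) x \<theta> \<and>
      (\<beta> \<in> S_cof n \<and> lim \<beta> \<longrightarrow> \<not> triv_sets K n {..<\<beta>} (D' \<beta>) x \<theta>)" for \<beta>
  proof (cases "\<beta> \<in> S_cof n \<and> lim \<beta>")
    case True
    have nN: "n \<le> N" using n by simp
    have "\<exists>\<theta>. (\<forall>a z. \<theta> a z \<in> K \<and> (\<theta> a z \<noteq> 0 \<longrightarrow> z \<in> E {..<\<beta>} \<inter> x \<beta>)) \<and>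
        coh_sets n {..<\<beta>} (E {..<\<beta>} \<inter> x \<beta>) x \<theta> \<and> \<not> triv_sets K n {..<\<beta>} (E {..<\<beta>} \<inter> x \<beta>) x \<theta>"
    proof (rule nontriv_below[OF om nN K a])
      show "has_nontriv n K x' D1 E'" if "ascending_op n x' D1 E' C'" for x' :: "'o \<Rightarrow> 's set" and D1 E' C'
        using that by (rule NT)
    qed (use True in \<open>auto simp: lim_def\<close>)
    then show ?thesis unfolding vals_def D'_def by blast
  next
    case False
    then show ?thesis
      by (intro exI[of _ "\<lambda>_ _. 0"]) (auto simp: vals_def sub coh_sets_def eq_fin_on_def coboundary_def)
  qed
  then obtain \<theta> where \<theta>: "\<And>\<beta>. vals \<beta> (\<theta> \<beta>)" "\<And>\<beta>. coh_sets n {..<\<beta>} (D' \<beta>) x (\<theta> \<beta>)"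
    "\<And>\<beta>. \<beta> \<in> S_cof n \<Longrightarrow> lim \<beta> \<Longrightarrow> \<not> triv_sets K n {..<\<beta>} (D' \<beta>) x (\<theta> \<beta>)"
    by metis

  \<comment> \<open>\<open>q\<close> continues \<phi> coherently at \<beta>: by
    \<open>coboundary_glue\<close>, the displayed sum is the coboundary on a set with maximum
    \<beta>.\<close>
  define P where "P = (\<lambda>\<beta> \<phi> (q :: 'o set \<Rightarrow> 's \<Rightarrow> 'h). \<forall>a\<in>fsets (Suc n) {..<\<beta>}.
    eq_fin_on (D' \<beta> \<inter> inter_dom x a) (\<lambda>z. coboundary q a z + sgn_pow (Suc n) (\<phi> a z)) (\<lambda>_. 0))"
  \<comment> \<open>The continuation is chosen before one is known to exist, with default 0, so that
    the recursion for \<open>f\<close> is total. Existence is proved afterwards, by induction in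
    \<open>fP\<close>, since it depends on coherence below \<beta>.\<close>
  have "\<exists>q. vals \<beta> q \<and> ((\<exists>q'. vals \<beta> q' \<and> P \<beta> \<phi> q') \<longrightarrow> P \<beta> \<phi> q)" for \<beta> \<phi>
  proof (cases "\<exists>q'. vals \<beta> q' \<and> P \<beta> \<phi> q'")
    case False
    then show ?thesis by (intro exI[of _ "\<lambda>_ _. 0"]) (auto simp: vals_def sub)
  qed blast
  then obtain Q where Q: "\<And>\<beta> \<phi>. vals \<beta> (Q \<beta> \<phi>)"
    "\<And>\<beta> \<phi> q'. vals \<beta> q' \<Longrightarrow> P \<beta> \<phi> q' \<Longrightarrow> P \<beta> \<phi> (Q \<beta> \<phi>)"
    by metis
  have ext: "\<exists>q. vals \<beta> q \<and> P \<beta> \<phi> q"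
    if \<beta>: "\<beta> \<in> ?O" and c: "coh_sets (Suc n) {..<\<beta>} D x \<phi>" and v: "\<And>a z. \<phi> a z \<in> K" for \<beta> \<phi>
  proof -
    have "triv_sets K (Suc n) {..<\<beta>} (D' \<beta>) x \<phi>"
      by (rule triv_sets_of_card_le[OF om K _ coh_sets_mono[OF c D'D] v]) (use \<beta> in \<open>simp add: omega.simps\<close>)
    then obtain \<psi> where \<psi>: "\<And>a z. \<psi> a z \<in> K" "\<And>a. a \<in> fsets (Suc n) {..<\<beta>} \<Longrightarrow>
        eq_fin_on (D' \<beta> \<inter> inter_dom x a) (\<phi> a) (coboundary \<psi> a)"
      unfolding triv_sets_def by blast
    \<comment> \<open>\<open>P\<close> asks for the negative of \<open>sgn_pow (Suc n)\<close>
      applied to \<phi>, whence the sign. Cutting off outside \<open>D' \<beta>\<close> is harmless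
      because the coboundary is computed pointwise.\<close>
    define q where "q = (\<lambda>a z. if z \<in> D' \<beta> then sgn_pow (Suc (Suc n)) (\<psi> a z) else 0)"
    have "vals \<beta> q" using \<psi>(1) sub by (auto simp: vals_def q_def)
    moreover have "P \<beta> \<phi> q" unfolding P_def
    proof
      fix b assume b: "b \<in> fsets (Suc n) {..<\<beta>}"
      have "coboundary q b z = sgn_pow (Suc (Suc n)) (coboundary \<psi> b z)" if "z \<in> D' \<beta>" for z
        using that by (subst coboundary_sg[symmetric], intro coboundary_cong) (simp add: q_def)
      then show "eq_fin_on (D' \<beta> \<inter> inter_dom x b) (\<lambda>z. coboundary q b z + sgn_pow (Suc n) (\<phi> b z)) (\<lambda>_. 0)"
        using \<psi>(2)[OF b] unfolding eq_fin_on_eventually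
        by (elim eventually_mono) (auto simp: sgn_pow_Suc)
    qed
    ultimately show ?thesis by blast
  qed

  define less where "less = {(i, j::'o). i < j}"
  \<comment> \<open>\<open>f g\<close> is the branch along \<open>g\<close> of a binary tree of
    families: the bit at \<beta> decides whether \<theta> is added to the chosen
    continuation.\<close>
  define f where "f = (\<lambda>g. wfrec less (\<lambda>f \<beta> a z. Q \<beta> (glue f) a z + (if g \<beta> then \<theta> \<beta> a z else 0)))"
  have f: "f g \<beta> = (\<lambda>a z. Q \<beta> (glue (cut (f g) less \<beta>)) a z + (if g \<beta> then \<theta> \<beta> a z else 0))" for g \<beta>
    unfolding f_def less_def by (subst wfrec[OF wf]) simp
  have fv: "vals \<beta> (f g \<beta>)" for g \<beta>
    unfolding vals_def
  proof (intro allI)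
    fix b z
    define u where "u = Q \<beta> (glue (cut (f g) less \<beta>)) b z"
    have u: "u \<in> K" "u \<noteq> 0 \<longrightarrow> z \<in> D' \<beta>" using Q(1) by (auto simp: vals_def u_def)
    have t: "\<theta> \<beta> b z \<in> K" "\<theta> \<beta> b z \<noteq> 0 \<longrightarrow> z \<in> D' \<beta>" using \<theta>(1) by (auto simp: vals_def)
    have "f g \<beta> b z = u + (if g \<beta> then \<theta> \<beta> b z else 0)"
      unfolding u_def by (subst f) (rule refl)
    then show "f g \<beta> b z \<in> K \<and> (f g \<beta> b z \<noteq> 0 \<longrightarrow> z \<in> D' \<beta>)"
      using u t sub(4) by (cases "g \<beta>") auto
  qed
  have glv: "glue (f g) b z \<in> K" "glue (f g) b z \<noteq> 0 \<Longrightarrow> z \<in> E {..<Max b}" for g b z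
    using fv[of "Max b" g] by (auto simp: vals_def glue_def D'_def)
  have coh_sets_glue: "coh_sets (Suc n) J D x (glue (f g))" if J: "\<And>\<eta>. \<eta> \<in> J \<Longrightarrow> P \<eta> (glue (f g)) (f g \<eta>)" for J g
    unfolding coh_sets_def
  proof
    fix b assume b: "b \<in> fsets (Suc (Suc n)) J"
    define \<eta> where "\<eta> = Max b"
    define c where "c = b - {\<eta>}"
    have \<eta>: "\<eta> \<in> J" and bc: "b = insert \<eta> c"
      using fsets_remove_Max[OF b] by (auto simp: \<eta>_def c_def)
    have c: "c \<in> fsets (Suc n) {..<\<eta>}"
      using fsets_remove_Max(2)[OF b] by (auto simp: \<eta>_def c_def fsets_def)
    then have c': "finite c" "\<And>y. y \<in> c \<Longrightarrow> y < \<eta>" "card c = Suc n" "Max c < \<eta>"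
      using fsets_remove_Max(1)[OF c] by (auto simp: fsets_def)
    have "eq_fin_on (D' \<eta> \<inter> inter_dom x c) (\<lambda>z. coboundary (f g \<eta>) c z + sgn_pow (Suc n) (glue (f g) c z)) (\<lambda>_. 0)"
      using J[OF \<eta>] c by (auto simp: P_def)
    then show "eq_fin_on (D \<inter> inter_dom x b) (coboundary (glue (f g)) b) (\<lambda>_. 0)"
      unfolding eq_fin_on_eventually
    proof eventually_elim
      case (elim z)
      show ?case
      proof
        assume z: "z \<in> D \<inter> inter_dom x b"
        have d: "coboundary (glue (f g)) b z = coboundary (f g \<eta>) c z + sgn_pow (Suc n) (glue (f g) c z)"
          unfolding bc using coboundary_glue[of c \<eta> "f g" z] c' by simp
        show "coboundary (glue (f g)) b z = 0"
        proof (cases "z \<in> D' \<eta>")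
          case True
          then show ?thesis using elim z d by (auto simp: inter_dom_def bc)
        next
          \<comment> \<open>Off \<open>D' \<eta>\<close> both terms vanish: the values at \<eta> are
            supported there, and those on \<open>c\<close> are supported in
            \<open>E {..<Max c}\<close>, a subset of \<open>E {..<\<eta>}\<close>.\<close>
          case False
          then have zE: "z \<notin> E {..<\<eta>}" using z by (auto simp: D'_def inter_dom_def bc)
          have "E {..<Max c} \<subseteq> E {..<\<eta>}" by (rule mono) (use c'(4) in auto)
          then have "glue (f g) c z = 0" using glv(2)[of g c z] zE by blast
          moreover have "f g \<eta> s z = 0" for s
            using fv[of \<eta> g] False by (auto simp: vals_def)
          then have "coboundary (f g \<eta>) c z = 0" by (simp add: coboundary_def)
          ultimately show ?thesis using d by simp
        qed
      qed
    qed
  qed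
  have fP: "P \<beta> (glue (f g)) (f g \<beta>)" if "\<beta> \<in> ?O" for \<beta> g
    using that
  proof (induction \<beta> rule: less_induct)
    case (less \<beta>)
    have "P \<eta> (glue (f g)) (f g \<eta>)" if "\<eta> \<in> {..<\<beta>}" for \<eta>
      using less that omega_downward[OF less.prems, of \<eta>] by auto
    then have "\<exists>q. vals \<beta> q \<and> P \<beta> (glue (f g)) q"
      using ext[OF less.prems coh_sets_glue glv(1)] by blast
    moreover have "P \<beta> (glue (cut (f g) less \<beta>)) q = P \<beta> (glue (f g)) q" for q
    proof -
      have "glue (cut (f g) less \<beta>) b = glue (f g) b" if "b \<in> fsets (Suc n) {..<\<beta>}" for b
        using that by (rule glue_cong) (simp add: cut_def less_def)
      then show ?thesis by (simp add: P_def)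
    qed
    ultimately have q: "P \<beta> (glue (f g)) (Q \<beta> (glue (cut (f g) less \<beta>)))"
      using Q(2) by metis
    show ?case unfolding P_def
    proof
      fix b assume b: "b \<in> fsets (Suc n) {..<\<beta>}"
      have e1: "eq_fin_on (D' \<beta> \<inter> inter_dom x b) (\<lambda>z. coboundary (Q \<beta> (glue (cut (f g) less \<beta>))) b z
          + sgn_pow (Suc n) (glue (f g) b z)) (\<lambda>_. 0)"
        using q b by (simp add: P_def)
      have e2: "eq_fin_on (D' \<beta> \<inter> inter_dom x b) (coboundary (\<theta> \<beta>) b) (\<lambda>_. 0)"
        using \<theta>(2) b by (simp add: coh_sets_def)
      have d: "coboundary (f g \<beta>) b z = coboundary (Q \<beta> (glue (cut (f g) less \<beta>))) b z
          + (if g \<beta> then coboundary (\<theta> \<beta>) b z else 0)" for z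
        unfolding f[of g \<beta>] by (cases "g \<beta>") (simp_all add: coboundary_add)
      show "eq_fin_on (D' \<beta> \<inter> inter_dom x b)
          (\<lambda>z. coboundary (f g \<beta>) b z + sgn_pow (Suc n) (glue (f g) b z)) (\<lambda>_. 0)"
        using e1 e2 unfolding eq_fin_on_eventually by eventually_elim (auto simp: d)
    qed
  qed
  \<comment> \<open>This locality lets bits decoded below \<beta> stand in for all of
    \<open>g\<close>.\<close>
  have agree: "f g \<eta> = f g' \<eta>" if "\<And>\<eta>. \<eta> < \<beta> \<Longrightarrow> g \<eta> = g' \<eta>" "\<eta> < \<beta>" for g g' \<beta> \<eta>
    using that(2)
  proof (induction \<eta> rule: less_induct)
    case (less \<eta>)
    have "cut (f g) less \<eta> = cut (f g') less \<eta>"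
      using less by (auto simp: cut_def less_def)
    then show ?case unfolding f[of g \<eta>] f[of g' \<eta>] using that(1)[OF less.prems] by simp
  qed

  \<comment> \<open>the bits of \<open>g\<close> and \<open>\<psi>\<close> over the index set \<open>A\<close>\<close>
  define QS where "QS = (\<lambda>A. Inl ` A \<union> Inr ` (Fpow A \<times> E A \<times> (omega n :: 'o set)))"
  have infn: "infinite (omega n :: 'o set)" using n by (intro omega_infinite[OF om]) simp
  have card_QS: "|QS A| \<le>o |B|"
    if "infinite B" "|A| \<le>o |B|" "|omega n :: 'o set| \<le>o |B|" for A B :: "'o set"
  proof -
    have "|Fpow A \<times> E A \<times> (omega n :: 'o set)| \<le>o |B|"
      using that card_of_Fpow_ordLeq_infinite[OF that(1,2)] ascending_opD(5)[OF a that(1,2)]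
      by (intro card_of_Sigma_ordLeq_infinite ballI) auto
    then show ?thesis unfolding QS_def
      using that by (intro card_of_Un_infinite ordLeq_transitive[OF card_of_image])
  qed
  have infO: "infinite ?O" using n by (intro omega_infinite[OF om]) simp
  have "|QS ?O| \<le>o |?O|"
    using omega_le[OF om _ n, of n] by (intro card_QS infO ordLeq_refl card_of_Card_order) auto
  then obtain p where p: "inj_on p (QS ?O)" "p ` QS ?O \<subseteq> ?O"
    unfolding card_of_ordLeq[symmetric] by blast
  have QS_mono: "QS A \<subseteq> QS B" if "A \<subseteq> B" for A B
    unfolding QS_def Fpow_def using that mono[OF that] by blast

  have "\<exists>\<gamma>\<in>C. \<xi> < \<gamma>" if "\<xi> \<in> ?O" for \<xi>
  proof -
    have "\<exists>\<eta>\<in>?O. {\<xi>} \<subseteq> {..<\<eta>}"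
      using that infn by (intro omega_bounded_Suc[OF om n] countable_ordLeq_infinite) auto
    then obtain \<eta> where "\<eta> \<in> ?O" "\<xi> < \<eta>" by auto
    then show ?thesis using ascending_opD(1)[OF a] unfolding club_def by (meson less_le_trans)
  qed
  then obtain up where up: "\<And>\<xi>. \<xi> \<in> ?O \<Longrightarrow> up \<xi> \<in> C \<and> \<xi> < up \<xi>" by metis
  have CO: "C \<subseteq> ?O" using ascending_opD(1)[OF a] by (simp add: club_def)
  \<comment> \<open>Closure under \<open>V\<close> has two purposes: the codes of all data over
    \<beta> fall below \<beta>, and the points \<open>up \<xi>\<close> make \<beta> a limit of
    \<open>C\<close>.\<close>
  define V where "V = (\<lambda>\<xi>. p ` QS {..\<xi>} \<union> {up \<xi>})"
  define B where "B = {\<beta> \<in> ?O. {..<\<beta>} \<noteq> {} \<and> (\<forall>\<xi><\<beta>. V \<xi> \<subseteq> {..<\<beta>})}"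
  have "club ?O B" unfolding B_def
  proof (rule club_closure[OF om n])
    fix \<xi> assume \<xi>: "\<xi> \<in> ?O"
    have "{..\<xi>} \<subseteq> ?O" using omega_downward[OF \<xi>] by auto
    then have "p ` QS {..\<xi>} \<subseteq> ?O" using p(2) QS_mono by blast
    moreover have "|p ` QS {..\<xi>}| \<le>o |omega n :: 'o set|"
      using card_QS[OF infn card_atMost_omega[OF om n \<xi>]] ordLeq_transitive[OF card_of_image]
        ordLeq_refl[OF card_of_Card_order] by blast
    ultimately show "V \<xi> \<subseteq> ?O \<and> |V \<xi>| \<le>o |omega n :: 'o set|"
      unfolding V_def using up[OF \<xi>] CO infn
        card_of_Un_infinite[OF infn _ countable_ordLeq_infinite[of "{up \<xi>}" "omega n :: 'o set"]]
      by auto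
  qed
  have B: "lim \<beta>" "p ` QS {..<\<beta>} \<subseteq> {..<\<beta>}" "\<beta> \<in> ?O" if \<beta>: "\<beta> \<in> B" for \<beta>
  proof -
    show \<beta>O: "\<beta> \<in> ?O" using \<beta> by (simp add: B_def)
    have Vb: "V \<xi> \<subseteq> {..<\<beta>}" if "\<xi> < \<beta>" for \<xi> using \<beta> that by (simp add: B_def)
    have l: "\<exists>\<gamma>\<in>C. \<xi> < \<gamma> \<and> \<gamma> < \<beta>" if "\<xi> < \<beta>" for \<xi>
      using up[of \<xi>] Vb[OF that] omega_downward[OF \<beta>O, of \<xi>] that by (auto simp: V_def)
    moreover have "{..<\<beta>} \<noteq> {}" using \<beta> by (simp add: B_def)
    ultimately show "lim \<beta>" using ascending_opD(1)[OF a] \<beta>O unfolding lim_def club_def by blast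
    obtain \<eta>0 where \<eta>0: "\<eta>0 < \<beta>" using \<open>{..<\<beta>} \<noteq> {}\<close> by auto
    show "p ` QS {..<\<beta>} \<subseteq> {..<\<beta>}"
    proof
      fix y assume "y \<in> p ` QS {..<\<beta>}"
      then obtain u where u: "u \<in> QS {..<\<beta>}" "y = p u" by blast
      \<comment> \<open>Each datum involves finitely many indices, because a point of
        \<open>E {..<\<beta>}\<close> lies in \<open>E F\<close> for some finite \<open>F\<close>;
        so it appears already over a segment ending below \<beta>. The element
        \<open>\<eta>0\<close> keeps the maximum defined when there are no indices.\<close>
      have "\<exists>\<xi><\<beta>. u \<in> QS {..\<xi>}"
      proof (cases u)
        case (Inl \<eta>)
        then show ?thesis using u(1) by (intro exI[of _ \<eta>]) (auto simp: QS_def)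
      next
        case (Inr v)
        obtain t z i where v: "v = (t, z, i)" by (metis prod_cases3)
        have t: "finite t" "t \<subseteq> {..<\<beta>}" and z: "z \<in> E {..<\<beta>}" and i: "i \<in> omega n"
          using u(1) Inr v by (auto simp: QS_def Fpow_def)
        obtain F where F: "finite F" "F \<subseteq> {..<\<beta>}" "z \<in> E F" using ascending_opD(4)[OF a z] by blast
        define \<xi> where "\<xi> = Max (insert \<eta>0 (F \<union> t))"
        have fin: "finite (insert \<eta>0 (F \<union> t))" using F t by simp
        have "\<xi> \<in> insert \<eta>0 (F \<union> t)" unfolding \<xi>_def using fin by (rule Max_in) simp
        then have "\<xi> < \<beta>" using F(2) t(2) \<eta>0 by auto
        moreover have le: "F \<subseteq> {..\<xi>}" "t \<subseteq> {..\<xi>}" using fin by (auto simp: \<xi>_def)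
        then have "u \<in> QS {..\<xi>}" using mono[OF le(1)] F(3) t(1) i unfolding Inr v QS_def Fpow_def by blast
        ultimately show ?thesis by blast
      qed
      then show "y \<in> {..<\<beta>}" using Vb u(2) by (auto simp: V_def)
    qed
  qed

  obtain cod :: "'h \<Rightarrow> 'o set" where cod: "inj_on cod K" "cod ` K \<subseteq> Pow (omega n)"
    using cK unfolding card_of_ordLeq[symmetric] by blast
  \<comment> \<open>A function \<open>b\<close> codes the choices \<open>g\<close> together with a candidate trivialization \<open>\<psi>\<close>; \<open>F\<close> decodes
    the part visible below \<open>\<beta>\<close> and picks the extension at \<open>\<beta>\<close> that \<open>\<psi>\<close> cannot trivialize.\<close>
  define R where "R = (\<lambda>g \<psi> \<beta> i. triv_sets K n {..<\<beta>} (D' \<beta>) x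
    (\<lambda>a z. Q \<beta> (glue (cut (f g) less \<beta>)) a z + (if i then \<theta> \<beta> a z else 0) - sgn_pow n (\<psi> a z)))"
  define gm where "gm = (\<lambda>m \<xi>. m (p (Inl \<xi>)) = Some True)"
  define \<psi>m where "\<psi>m = (\<lambda>m t z. inv_into K cod {i \<in> omega n. m (p (Inr (t, z, i))) = Some True})"
  define F where "F = (\<lambda>m. \<not> R (gm m) (\<psi>m m) (THE \<beta>. dom m = {..<\<beta>}) True)"
  obtain g where g: "\<And>b. stationary ?O {\<alpha> \<in> S_cof n. g \<alpha> = F ((Some \<circ> b) |` {..<\<alpha>})}"
    using wd[unfolded weak_diamond_def] by blast
  have nt: "\<not> triv_sets K (Suc n) ?O D x (glue (f g))"
  proof
    assume "triv_sets K (Suc n) ?O D x (glue (f g))"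
    then obtain \<psi> where \<psi>: "\<And>a z. \<psi> a z \<in> K" "\<And>b. b \<in> fsets (Suc n) ?O \<Longrightarrow>
        eq_fin_on (D \<inter> inter_dom x b) (glue (f g) b) (coboundary \<psi> b)"
      unfolding triv_sets_def by blast
    define b where "b = (\<lambda>\<xi>. case inv_into (QS ?O) p \<xi> of Inl \<eta> \<Rightarrow> g \<eta> | Inr (t, z, i) \<Rightarrow> i \<in> cod (\<psi> t z))"
    have b: "b (p u) = (case u of Inl \<eta> \<Rightarrow> g \<eta> | Inr (t, z, i) \<Rightarrow> i \<in> cod (\<psi> t z))" if "u \<in> QS ?O" for u
      using inv_into_f_f[OF p(1) that] by (simp add: b_def)
    obtain \<beta> where \<beta>: "\<beta> \<in> S_cof n" "\<beta> \<in> B" "g \<beta> = F ((Some \<circ> b) |` {..<\<beta>})"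
      using g[of b] \<open>club ?O B\<close> unfolding stationary_def by blast
    define m where "m = (Some \<circ> b) |` {..<\<beta>}"
    have "dom m = {..<\<beta>}" by (auto simp: m_def)
    then have the: "(THE \<beta>. dom m = {..<\<beta>}) = \<beta>" by (auto intro: the_equality)
    have sO: "{..<\<beta>} \<subseteq> ?O" by (rule lessThan_subset_omega) (rule B(3)[OF \<beta>(2)])
    have m: "m (p u) = Some (b (p u))" if "u \<in> QS {..<\<beta>}" for u
      using B(2)[OF \<beta>(2)] that by (auto simp: m_def restrict_map_def)
    have gm: "gm m \<xi> = g \<xi>" if "\<xi> < \<beta>" for \<xi>
    proof -
      have "Inl \<xi> \<in> QS {..<\<beta>}" using that by (simp add: QS_def)
      then show ?thesis using m b QS_mono[OF sO] by (auto simp: gm_def)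
    qed
    have \<psi>m: "\<psi>m m t z = \<psi> t z" if t: "t \<in> Fpow {..<\<beta>}" and z: "z \<in> E {..<\<beta>}" for t z
    proof -
      have "m (p (Inr (t, z, i))) = Some True \<longleftrightarrow> i \<in> cod (\<psi> t z)" if "i \<in> omega n" for i
      proof -
        have "Inr (t, z, i) \<in> QS {..<\<beta>}" using that t z by (simp add: QS_def)
        then show ?thesis using m b QS_mono[OF sO] by auto
      qed
      moreover have "cod (\<psi> t z) \<subseteq> omega n" using cod(2) \<psi>(1) by blast
      ultimately have "{i \<in> omega n. m (p (Inr (t, z, i))) = Some True} = cod (\<psi> t z)" by blast
      then show ?thesis using inv_into_f_f[OF cod(1) \<psi>(1)] by (simp add: \<psi>m_def)
    qed
    have "cut (f (gm m)) less \<beta> = cut (f g) less \<beta>"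
      using agree[of \<beta> "gm m" g] gm by (auto simp: cut_def less_def)
    then have Rm: "R (gm m) (\<psi>m m) \<beta> i \<longleftrightarrow> R g \<psi> \<beta> i" for i
      unfolding R_def
      by (intro triv_sets_cong) (use \<psi>m in \<open>auto simp: fsets_def Fpow_def D'_def\<close>)
    \<comment> \<open>\<psi> trivializes the actual branch, so its values on sets containing \<beta>
      solve the equation in \<open>R\<close>. The term \<open>sgn_pow n (\<psi> c z)\<close> is the
      summand of the coboundary in which \<beta> is removed.\<close>
    have "R g \<psi> \<beta> (g \<beta>)" unfolding R_def triv_sets_def
    proof (intro exI[of _ "\<lambda>s. \<psi> (insert \<beta> s)"] conjI allI ballI \<psi>(1))
      fix c assume c: "c \<in> fsets n {..<\<beta>}"
      then have fc: "finite c" "\<And>y. y \<in> c \<Longrightarrow> y < \<beta>" "card c = n" by (auto simp: fsets_def)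
      have "insert \<beta> c \<in> fsets (Suc n) ?O"
        by (rule fsets_insert_top[OF c B(3)[OF \<beta>(2)] sO]) (use fc in auto)
      from \<psi>(2)[OF this] show "eq_fin_on (D' \<beta> \<inter> inter_dom x c)
          (\<lambda>z. Q \<beta> (glue (cut (f g) less \<beta>)) c z + (if g \<beta> then \<theta> \<beta> c z else 0) - sgn_pow n (\<psi> c z))
          (coboundary (\<lambda>s. \<psi> (insert \<beta> s)) c)"
        unfolding eq_fin_on_eventually
      proof eventually_elim
        case (elim z)
        show ?case
        proof
          assume z: "z \<in> D' \<beta> \<inter> inter_dom x c"
          then have "glue (f g) (insert \<beta> c) z = coboundary \<psi> (insert \<beta> c) z"
            using elim D'D by (auto simp: inter_dom_def D'_def)
          then show "Q \<beta> (glue (cut (f g) less \<beta>)) c z + (if g \<beta> then \<theta> \<beta> c z else 0) - sgn_pow n (\<psi> c z)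
              = coboundary (\<lambda>s. \<psi> (insert \<beta> s)) c z"
            using coboundary_insert_top[of c \<beta> \<psi> z] glue_insert_top[of c \<beta> "f g"] fc f[of g \<beta>]
            by (simp add: diff_eq_eq)
        qed
      qed
    qed
    \<comment> \<open>Subtracting the two equations cancels \<open>Q\<close> and \<psi> and leaves a
      trivialization of \<open>\<theta> \<beta>\<close>.\<close>
    moreover have "\<not> (R g \<psi> \<beta> True \<and> R g \<psi> \<beta> False)"
    proof
      assume "R g \<psi> \<beta> True \<and> R g \<psi> \<beta> False"
      then have "R g \<psi> \<beta> True" "R g \<psi> \<beta> False" by blast+
      from triv_sets_diff[OF K this[unfolded R_def]]
      have "triv_sets K n {..<\<beta>} (D' \<beta>) x (\<theta> \<beta>)" by simp
      then show False using \<theta>(3)[OF \<beta>(1) B(1)[OF \<beta>(2)]] by simp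
    qed
    \<comment> \<open>The bit picked by \<open>F\<close> always has an unsolvable equation: it is
      True if the equation with \<theta> fails, and otherwise False, as then the other equation
      fails.\<close>
    moreover have "g \<beta> = (\<not> R g \<psi> \<beta> True)"
      using \<beta>(3) Rm the by (simp add: F_def flip: m_def)
    ultimately show False by (cases "g \<beta>") auto
  qed
  have "coh_sets (Suc n) ?O D x (glue (f g))" using fP by (rule coh_sets_glue)
  moreover have "z \<in> D" if "glue (f g) b z \<noteq> 0" for b z
    using glv(2)[OF that] ascending_opD(3)[OF a] by blast
  ultimately show ?thesis
    unfolding has_nontriv_def using glv nt by (intro exI[of _ "glue (f g)"]) blast
qed


section \<open>From witnesses of ascendingness to the operator form\<close>

lemma Fn_plus_mono: "A \<subseteq> B \<Longrightarrow> Fn_plus A \<subseteq> Fn_plus B"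
  by (auto simp: Fn_plus_def)

lemma card_of_Fn_plus:
  fixes B :: "'b set"
  assumes "infinite B" "|A| \<le>o |B|"
  shows "|Fn_plus A| \<le>o |B|"
proof -
  let ?h = "\<lambda>w. ({\<beta>. w \<beta> = Some True}, {\<beta>. w \<beta> = Some False})"
  have "inj_on ?h (Fn_plus A)"
  proof (rule inj_onI)
    fix w w' assume "?h w = ?h w'"
    then have *: "w \<beta> = Some b \<longleftrightarrow> w' \<beta> = Some b" for \<beta> b
      by (cases b) (auto simp: set_eq_iff)
    show "w = w'"
    proof
      fix \<beta> show "w \<beta> = w' \<beta>" using *[of \<beta>] by (metis not_None_eq)
    qed
  qed
  moreover have "?h w \<in> Fpow A \<times> Fpow A" if "w \<in> Fn_plus A" for w
  proof -
    have w: "finite (dom w)" "dom w \<subseteq> A" using that by (auto simp: Fn_plus_def)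
    moreover have "{\<beta>. w \<beta> = Some b} \<subseteq> dom w" for b by auto
    ultimately show ?thesis unfolding Fpow_def by (auto intro: finite_subset)
  qed
  ultimately have "|Fn_plus A| \<le>o |Fpow A \<times> Fpow A|" by (rule card_of_ordLeqI)
  also have "|Fpow A \<times> Fpow A| \<le>o |B|"
    using card_of_Fpow_ordLeq_infinite[OF assms] assms(1) by (intro card_of_Sigma_ordLeq_infinite) auto
  finally show ?thesis .
qed

text \<open>The points come from the single function \<open>u\<close> that is True at \<gamma> and
  False on \<open>F\<close>. The clause on finite unions makes its cell infinite, and the clause on
  finite intersections makes \<open>e u\<close> meet the later sets; for empty \<open>a\<close> it
  suffices that \<open>e u\<close> is infinite. \<open>A\<close> is cut down to
  \<open>omega n\<close> because \<open>e\<close> is controlled only there.\<close>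

lemma ascending_op_if_witnesses:
  fixes x :: "'o::wellorder \<Rightarrow> 's set"
  assumes w: "witnesses_ascending (omega n) x e C"
  shows "ascending_op n x UNIV (\<lambda>A. \<Union>w\<in>Fn_plus (A \<inter> omega n). e w) C"
proof -
  let ?O = "omega n :: 'o set"
  have cl: "club ?O C"
    and ew: "\<And>w. w \<in> Fn_plus ?O \<Longrightarrow> (if seq_respects x w
      then e w \<subseteq> cell x w \<and> countable (e w) \<and> infinite (e w) else e w = {})"
    and wb: "\<And>\<beta> a. \<beta> \<in> C \<Longrightarrow> finite a \<Longrightarrow> a \<subseteq> {..<\<beta>} \<Longrightarrow> infinite (x \<beta> - (\<Union>\<alpha>\<in>a. x \<alpha>))"
    and wc: "\<And>a w. finite a \<Longrightarrow> a \<noteq> {} \<Longrightarrow> a \<subseteq> C \<Longrightarrow> w \<in> Fn_plus {..<Min a} \<Longrightarrow> seq_respects x w \<Longrightarrow>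
      infinite (e w \<inter> (\<Inter>\<beta>\<in>a. x \<beta>))"
    using w by (simp_all add: witnesses_ascending_def)
  define E where "E = (\<lambda>A. \<Union>w\<in>Fn_plus (A \<inter> ?O). e w)"
  have "ascending_op n x UNIV E C" unfolding ascending_op_def
  proof (intro conjI allI ballI impI cl)
    show "mono E"
    proof (rule monoI)
      fix A B :: "'o set" assume "A \<subseteq> B"
      then have "Fn_plus (A \<inter> ?O) \<subseteq> Fn_plus (B \<inter> ?O)" by (intro Fn_plus_mono) auto
      then show "E A \<subseteq> E B" unfolding E_def by (rule UN_mono) simp
    qed
    show "E A \<subseteq> UNIV" for A by simp
    show "\<exists>F. finite F \<and> F \<subseteq> A \<and> z \<in> E F" if z: "z \<in> E A" for A z
    proof -
      obtain u where u: "u \<in> Fn_plus (A \<inter> ?O)" "z \<in> e u" using z by (auto simp: E_def)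
      then have "u \<in> Fn_plus (dom u \<inter> ?O)" "finite (dom u)" "dom u \<subseteq> A" by (auto simp: Fn_plus_def)
      then show ?thesis using u(2) by (intro exI[of _ "dom u"]) (auto simp: E_def)
    qed
    show "|E A| \<le>o |B|" if B: "infinite B \<and> |A| \<le>o |B|" for A B :: "'o set"
      unfolding E_def
    proof (rule card_of_UNION_ordLeq_infinite)
      show "infinite B" using B by simp
      have "|A \<inter> ?O| \<le>o |A|" by (rule card_of_mono1) simp
      then have "|A \<inter> ?O| \<le>o |B|" using B ordLeq_transitive by blast
      then show "|Fn_plus (A \<inter> ?O)| \<le>o |B|" using B by (intro card_of_Fn_plus) auto
      show "\<forall>u\<in>Fn_plus (A \<inter> ?O). |e u| \<le>o |B|"
      proof
        fix u assume "u \<in> Fn_plus (A \<inter> ?O)"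
        then have "u \<in> Fn_plus ?O" using Fn_plus_mono[of "A \<inter> ?O" ?O] by auto
        then have "countable (e u)" using ew[of u] by (auto split: if_splits)
        then show "|e u| \<le>o |B|" using B by (intro countable_ordLeq_infinite) auto
      qed
    qed
    fix \<gamma> F a
    assume \<gamma>: "\<gamma> \<in> C" and h: "finite F \<and> F \<subseteq> {..<\<gamma>} \<and> finite a \<and> a \<subseteq> C \<inter> {\<gamma><..}"
    have \<gamma>O: "\<gamma> \<in> ?O" using cl \<gamma> by (auto simp: club_def)
    have FO: "insert \<gamma> F \<subseteq> ?O" using h \<gamma>O lessThan_subset_omega[OF \<gamma>O] by blast
    define u where "u = (\<lambda>i. if i = \<gamma> then Some True else if i \<in> F then Some False else None)"
    have uT: "{\<beta>. u \<beta> = Some True} = {\<gamma>}" and uF: "{\<beta>. u \<beta> = Some False} = F"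
      using h by (auto simp: u_def)
    have du: "dom u = insert \<gamma> F" by (auto simp: u_def dom_def)
    have uFn: "u \<in> Fn_plus A" if "insert \<gamma> F \<subseteq> A" for A
      using that h uT du by (auto simp: Fn_plus_def)
    have cell: "cell x u = x \<gamma> - \<Union> (x ` F)" unfolding cell_def uT uF by simp
    have "infinite (x \<gamma> - \<Union> (x ` F))" using wb[OF \<gamma>, of F] h by simp
    then have res: "seq_respects x u" by (simp add: seq_respects_def cell)
    then have eu: "e u \<subseteq> x \<gamma> - \<Union> (x ` F)" "infinite (e u)"
      using ew[OF uFn[OF FO]] cell by auto
    have "infinite (e u \<inter> inter_dom x a)"
    proof (cases "a = {}")
      case True
      then show ?thesis using eu(2) by (simp add: inter_dom_def)
    next
      case False
      then have "\<gamma> < Min a" using h by (auto simp: subset_iff)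
      then have "u \<in> Fn_plus {..<Min a}" using h by (intro uFn) (auto intro: less_trans)
      then show ?thesis using wc[OF _ False _ _ res] h unfolding inter_dom_def by simp
    qed
    moreover have "e u \<subseteq> E (insert \<gamma> F)"
      unfolding E_def using uFn[of "insert \<gamma> F \<inter> ?O"] FO by blast
    then have "e u \<inter> inter_dom x a \<subseteq> E (insert \<gamma> F) \<inter> x \<gamma> \<inter> inter_dom x a - \<Union> (x ` F)"
      using eu(1) by blast
    ultimately show "infinite (E (insert \<gamma> F) \<inter> x \<gamma> \<inter> inter_dom x a - \<Union> (x ` F))"
      using finite_subset by blast
  qed
  then show ?thesis by (simp add: E_def)
qed

section \<open>The coefficient group\<close>

lemma exists_countable_subgrp:
  fixes h :: "'h::ab_group_add"
  shows "\<exists>K. subgrp K \<and> countable K \<and> h \<in> K"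
proof -
  define s where "s = (\<lambda>i::nat. \<Sum>k<i. h)"
  have s: "s (i + j) = s i + s j" for i j
    by (induction j) (simp_all add: s_def add.assoc)
  define K where "K = (\<lambda>(i, j). s i - s j) ` UNIV"
  have "subgrp K" unfolding subgrp_def
  proof (intro conjI ballI)
    have "0 = (\<lambda>(i, j). s i - s j) (0, 0)" by simp
    then show "0 \<in> K" unfolding K_def by blast
    fix a b assume "a \<in> K" "b \<in> K"
    then obtain i j k l where "a = s i - s j" "b = s k - s l" by (auto simp: K_def)
    then have "a - b = (\<lambda>(i, j). s i - s j) (i + l, j + k)" by (simp add: s)
    then show "a - b \<in> K" unfolding K_def by blast
  qed
  moreover have "h = (\<lambda>(i, j). s i - s j) (1, 0)" by (simp add: s_def)
  then have "h \<in> K" unfolding K_def by blast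
  ultimately show ?thesis unfolding K_def by (intro exI[of _ K]) (simp add: K_def)
qed

text \<open>A trivialization of a 1-family is a single function, so it can be corrected to take values in \<open>K\<close>.\<close>

lemma triv_sets_1_subgrp:
  assumes "triv_sets UNIV (Suc 0) I D x \<phi>" "\<And>a z. \<phi> a z \<in> K" "0 \<in> K"
  shows "triv_sets K (Suc 0) I D x \<phi>"
proof -
  obtain \<psi> where \<psi>: "\<And>a. a \<in> fsets (Suc 0) I \<Longrightarrow> eq_fin_on (D \<inter> inter_dom x a) (\<phi> a) (coboundary \<psi> a)"
    using assms(1) unfolding triv_sets_def by blast
  show ?thesis unfolding triv_sets_def
  proof (intro exI[of _ "\<lambda>a z. if \<psi> a z \<in> K then \<psi> a z else 0"] conjI allI ballI)
    fix a assume a: "a \<in> fsets (Suc 0) I"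
    then obtain j where j: "a = {j}" by (auto simp: fsets_def card_1_singleton_iff)
    have "{z \<in> {j}. z < j} = {}" by auto
    then have r: "rank_in j {j} = 0" unfolding rank_in_def by simp
    show "eq_fin_on (D \<inter> inter_dom x a) (\<phi> a) (coboundary (\<lambda>a z. if \<psi> a z \<in> K then \<psi> a z else 0) a)"
      using \<psi>[OF a] unfolding eq_fin_on_eventually
    proof eventually_elim
      case (elim z)
      then show ?case using assms(2)[of a z] j r by (auto simp: coboundary_def sgn_pow_def)
    qed
  qed (use assms(3) in simp)
qed

lemma card_of_Pow_le: "|A| \<le>o |B| \<Longrightarrow> |Pow A| \<le>o |Pow B|"
proof -
  assume "|A| \<le>o |B|"
  then obtain f where "inj_on f A" "f ` A \<subseteq> B" unfolding card_of_ordLeq[symmetric] by blast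
  then show ?thesis
    using inj_on_image_Pow[of f A] by (intro card_of_ordLeqI[of "image f"]) auto
qed

text \<open>The step from degree n to n + 1 needs a group of size at most 2^(omega_n). The step from
  degree 0 therefore runs in a countable subgroup containing \<open>h\<close>, and nontriviality is
  then transferred to the whole group; later steps use the whole group, since 2^(omega_1) \<le>
  2^(omega_n) for n \<ge> 1.\<close>

lemma has_nontriv_UNIV:
  fixes x :: "'o::wellorder \<Rightarrow> 's set" and h :: "'h::ab_group_add"
  assumes om: "omegas_exist TYPE('o) n" and h: "h \<noteq> 0"
    and cH: "|UNIV :: 'h set| \<le>o ctwo ^c |omega 1 :: 'o set|"
    and wd: "\<forall>k<n. weak_diamond (omega (Suc k) :: 'o set) (S_cof k)"
    and m: "Suc m \<le> n" and a: "ascending_op (Suc m) x D E C"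
  shows "has_nontriv (Suc m) (UNIV :: 'h set) x D E"
  using m a
proof (induction m arbitrary: x D E C)
  case 0
  obtain K where K: "subgrp K" "countable K" "h \<in> K" using exists_countable_subgrp by blast
  have "infinite (Pow (omega 0 :: 'o set))"
    using omega_infinite[OF om, of 0] by (simp add: finite_Pow_iff)
  then have cK: "|K| \<le>o |Pow (omega 0 :: 'o set)|" using K(2) by (intro countable_ordLeq_infinite)
  have wd0: "weak_diamond (omega (Suc 0) :: 'o set) (S_cof 0)"
    by (rule wd[rule_format]) (use 0(1) in simp)
  have "has_nontriv (Suc 0) K x D E"
    using has_nontriv_0[OF om _ K(1,3) h]
    by (rule has_nontriv_Suc[OF om 0(1) K(1) cK wd0 _ 0(2)])
  then show ?case
    unfolding has_nontriv_def using triv_sets_1_subgrp[OF _ _ subgrp_closed(1)[OF K(1)]] by blast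
next
  case (Suc m)
  have "|UNIV :: 'h set| \<le>o |Pow (omega 1 :: 'o set)|"
  proof (rule ordLeq_ordIso_trans[OF cH])
    show "ctwo ^c |omega 1 :: 'o set| =o |Pow (omega 1 :: 'o set)|"
      unfolding cexp_def ctwo_def Field_card_of by (rule ordIso_symmetric[OF card_of_Pow_Func])
  qed
  moreover have "|Pow (omega 1 :: 'o set)| \<le>o |Pow (omega (Suc m) :: 'o set)|"
    using Suc.prems(1) by (intro card_of_Pow_le omega_le[OF om]) auto
  ultimately have cK: "|UNIV :: 'h set| \<le>o |Pow (omega (Suc m) :: 'o set)|"
    by (rule ordLeq_transitive)
  have wd': "weak_diamond (omega (Suc (Suc m)) :: 'o set) (S_cof (Suc m))"
    by (rule wd[rule_format]) (use Suc.prems(1) in simp)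
  have U: "subgrp (UNIV :: 'h set)" by (simp add: subgrp_def)
  show ?case
    by (rule has_nontriv_Suc[OF om Suc.prems(1) U cK wd' _ Suc.prems(2)])
      (rule Suc.IH, use Suc.prems(1) in auto)
qed

section \<open>From sets to alternating families\<close>

primrec inversions :: "'o::linorder list \<Rightarrow> nat" where
  "inversions [] = 0"
| "inversions (a # l) = length (filter (\<lambda>b. b < a) l) + inversions l"

lemma inversions_insert:
  "inversions (u @ y # v) = inversions (u @ v) + length (filter (\<lambda>b. y < b) u) + length (filter (\<lambda>b. b < y) v)"
  by (induction u) auto

lemma length_filter_less_greater:
  fixes y :: "'o::linorder"
  assumes "y \<notin> set u"
  shows "length u = length (filter (\<lambda>b. b < y) u) + length (filter (\<lambda>b. y < b) u)"
proof -
  have "filter (\<lambda>b. y < b) u = filter (\<lambda>b. \<not> b < y) u"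
    using assms by (intro filter_cong refl) (metis linorder_neqE not_less_iff_gr_or_eq)
  then show ?thesis using sum_length_filter_compl[of "\<lambda>b. b < y" u] by presburger
qed

lemma inversions_sorted: "sorted l \<Longrightarrow> inversions l = 0"
  by (induction l) (auto simp: filter_empty_conv not_less)

text \<open>Modulo 2 the contributions of \<open>u\<close> and \<open>r\<close> cancel. Each entry
  of \<open>w\<close> is compared with \<open>p\<close> and \<open>q\<close> from both sides and
  counts twice, so only the comparison of \<open>p\<close> with \<open>q\<close> remains.\<close>

lemma inversions_swap:
  assumes "distinct (u @ p # w @ q # r)"
  shows "odd (inversions (u @ p # w @ q # r) + inversions (u @ q # w @ p # r))"
proof -
  have i: "inversions (u @ p # w @ q # r) = inversions (u @ w @ r)
      + length (filter (\<lambda>b. q < b) (u @ w)) + length (filter (\<lambda>b. b < q) r)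
      + length (filter (\<lambda>b. p < b) u) + length (filter (\<lambda>b. b < p) (w @ q # r))" for p q
    using inversions_insert[of u p "w @ q # r"] inversions_insert[of "u @ w" q r] by simp
  have "p \<notin> set w" "q \<notin> set w" "p \<noteq> q" using assms by auto
  then have "length w = length (filter (\<lambda>b. b < p) w) + length (filter (\<lambda>b. p < b) w)"
    "length w = length (filter (\<lambda>b. b < q) w) + length (filter (\<lambda>b. q < b) w)" "p < q \<or> q < p"
    using length_filter_less_greater by (blast, blast, auto)
  then have "even (length (filter (\<lambda>b. b < p) w) + length (filter (\<lambda>b. p < b) w)
      + length (filter (\<lambda>b. b < q) w) + length (filter (\<lambda>b. q < b) w))"
    by (metis add.assoc even_add)
  then show ?thesis unfolding i[of p q] i[of q p] using \<open>p < q \<or> q < p\<close> by auto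
qed

text \<open>\<open>inversions a\<close> has the parity of the permutation sorting \<open>a\<close>.
  Tuples with a repeated entry get 0 explicitly, since the sign rule alone does not force this in a
  group with elements of order 2.\<close>

definition alt_ext :: "('o::linorder set \<Rightarrow> 's \<Rightarrow> 'h::ab_group_add) \<Rightarrow> 'o list \<Rightarrow> 's \<Rightarrow> 'h" where
  "alt_ext \<phi> a z = (if distinct a then sgn_pow (inversions a) (\<phi> (set a) z) else 0)"

lemma permute_list_transpose:
  assumes "i < j" "j < length a"
  obtains u p w q r where "a = u @ p # w @ q # r"
    "permute_list (Transposition.transpose i j) a = u @ q # w @ p # r"
proof -
  define u p w q r where "u = take i a" and "p = a ! i" and "w = drop (Suc i) (take j a)"
    and "q = a ! j" and "r = drop (Suc j) a"
  have "take j a = u @ p # w"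
    using assms id_take_nth_drop[of i "take j a"] by (simp add: u_def p_def w_def min_def)
  then have a: "a = u @ p # w @ q # r"
    using assms id_take_nth_drop[of j a] by (simp add: q_def r_def)
  have lu: "length u = i" and lw: "length w = j - Suc i" using assms by (auto simp: u_def w_def)
  have "permute_list (Transposition.transpose i j) a = a[i := q, j := p]"
    by (rule nth_equalityI)
      (use assms in \<open>auto simp: permute_list_def Transposition.transpose_def nth_list_update p_def q_def\<close>)
  also have "\<dots> = u @ q # w @ p # r"
  proof -
    have "j = Suc (i + length w)" using lw assms by simp
    then show ?thesis by (subst a) (simp add: lu list_update_append)
  qed
  finally show thesis using a that by blast
qed

lemma alt_ext_transpose:
  assumes "i < length a" "j < length a" "i \<noteq> j"
  shows "alt_ext \<phi> (permute_list (Transposition.transpose i j) a) z = - alt_ext \<phi> a z"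
proof -
  have main: "alt_ext \<phi> (permute_list (Transposition.transpose i j) a) z = - alt_ext \<phi> a z"
    if "i < j" "j < length a" for i j
  proof -
    obtain u p w q r where a: "a = u @ p # w @ q # r"
      and b: "permute_list (Transposition.transpose i j) a = u @ q # w @ p # r"
      using permute_list_transpose[OF \<open>i < j\<close> \<open>j < length a\<close>] .
    show ?thesis
    proof (cases "distinct a")
      case True
      then have "distinct (u @ q # w @ p # r)" unfolding a by auto
      moreover have "set (u @ q # w @ p # r) = set a" unfolding a by auto
      moreover have "odd (inversions a + inversions (u @ q # w @ p # r))"
        using inversions_swap True unfolding a by blast
      ultimately show ?thesis using True by (auto simp: alt_ext_def b sgn_pow_def)
    next
      case False
      then have "\<not> distinct (u @ q # w @ p # r)" unfolding a by (auto simp: Int_Un_distrib)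
      then show ?thesis using False unfolding alt_ext_def b
        by (simp only: if_False minus_zero simp_thms)
    qed
  qed
  show ?thesis
  proof (cases "i < j")
    case False
    then have "j < i" using assms(3) by simp
    then show ?thesis using main[of j i] assms(1) by (simp add: transpose_commute)
  qed (use main assms in auto)
qed

lemma alternating_alt_ext: "alternating n \<delta> x (alt_ext \<phi>)"
  unfolding alternating_def
proof (intro ballI allI impI)
  fix a \<sigma> z assume a: "a \<in> tuples n \<delta>" and \<sigma>: "\<sigma> permutes {..<n}"
  have len: "length a = n" using a by (simp add: tuples_def)
  show "alt_ext \<phi> (permute_list \<sigma> a) z = (if sign \<sigma> = 1 then alt_ext \<phi> a z else - alt_ext \<phi> a z)"
    using finite_lessThan \<sigma>
  proof (induction rule: permutes_rev_induct)
    case id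
    then show ?case by (simp add: permute_list_id)
  next
    case (swap i j p)
    define t where "t = Transposition.transpose i j"
    have "t permutes {..<length a}"
      using swap(1,2) len unfolding t_def by (intro permutes_swap_id) auto
    then have e: "permute_list (p \<circ> t) a = permute_list t (permute_list p a)"
      by (rule permute_list_compose)
    have "alt_ext \<phi> (permute_list (p \<circ> t) a) z = - alt_ext \<phi> (permute_list p a) z"
      unfolding e unfolding t_def using swap(1-3) len by (intro alt_ext_transpose) simp_all
    moreover have "sign (p \<circ> t) = - sign p"
    proof -
      have "permutation p" using permutation_permutes[of p] swap(4) finite_lessThan[of n] by blast
      then show ?thesis using swap(3)
        by (simp add: t_def sign_compose sign_swap_id permutation_swap_id)
    qed
    ultimately have "alt_ext \<phi> (permute_list (p \<circ> t) a) z =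
        (if sign (p \<circ> t) = 1 then alt_ext \<phi> a z else - alt_ext \<phi> a z)"
      using swap(5) by (cases rule: sign_cases[of p]) simp_all
    then show ?case unfolding t_def .
  qed
qed

section \<open>The coboundary in terms of tuples\<close>

lemma alt_sum_sg: "alt_sum m f = (\<Sum>i<m. sgn_pow i (f i))"
  by (simp add: alt_sum_def sgn_pow_def)

lemma del_nth_split:
  assumes "i < length v"
  obtains u w where "v = u @ v ! i # w" "del_nth i v = u @ w" "length u = i"
  using that[of "take i v" "drop (Suc i) v"] assms id_take_nth_drop[OF assms]
  by (simp add: del_nth_def min_def)

lemma rank_in_distinct:
  assumes "distinct (u @ y # w)"
  shows "rank_in y (set (u @ y # w)) = length (filter (\<lambda>b. b < y) u) + length (filter (\<lambda>b. b < y) w)"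
proof -
  have "rank_in y (set (u @ y # w)) = card (set (filter (\<lambda>b. b < y) (u @ y # w)))"
    unfolding rank_in_def by (simp only: set_filter)
  also have "\<dots> = length (filter (\<lambda>b. b < y) (u @ y # w))"
    using assms by (intro distinct_card distinct_filter)
  finally show ?thesis by simp
qed

text \<open>Deleting an entry loses as inversions the earlier greater and the later smaller entries.
  Its position counts all earlier entries, its rank all smaller ones, so the three parities add up
  to 0.\<close>

lemma alt_sum_alt_ext_distinct:
  assumes "distinct v"
  shows "alt_sum (length v) (\<lambda>i. alt_ext \<phi> (del_nth i v) z) = sgn_pow (inversions v) (coboundary \<phi> (set v) z)"
proof -
  have "coboundary \<phi> (set v) z = (\<Sum>i<length v. sgn_pow (rank_in (v ! i) (set v)) (\<phi> (set v - {v ! i}) z))"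
    unfolding coboundary_def
    by (rule sum.reindex_bij_betw[symmetric, OF bij_betw_nth[OF assms refl refl]])
  moreover have "sgn_pow i (alt_ext \<phi> (del_nth i v) z) =
      sgn_pow (inversions v) (sgn_pow (rank_in (v ! i) (set v)) (\<phi> (set v - {v ! i}) z))" if i: "i < length v" for i
  proof -
    obtain u w where v: "v = u @ v ! i # w" and d: "del_nth i v = u @ w" and lu: "length u = i"
      using del_nth_split[OF i] .
    define y where "y = v ! i"
    have v': "v = u @ y # w" using v y_def by simp
    have dis: "distinct (u @ w)" "y \<notin> set u" using assms unfolding v' by auto
    have st: "set (u @ w) = set v - {y}" using assms unfolding v' by auto
    have "even (i + inversions (u @ w) + (inversions v + rank_in y (set v)))"
      using length_filter_less_greater[OF dis(2)] lu assms
      unfolding v' inversions_insert by (subst rank_in_distinct) auto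
    then show ?thesis
      unfolding d alt_ext_def y_def[symmetric] using dis(1) st
      by (simp add: sgn_pow_sg) (rule sgn_pow_cong, simp)
  qed
  ultimately show ?thesis unfolding alt_sum_sg by (simp add: sgn_pow_sum)
qed

text \<open>If \<open>y\<close> stands at positions \<open>i\<close> and \<open>j\<close>, deleting
  any other position leaves a repetition. The two remaining tuples differ by moving \<open>y\<close>
  across \<open>w\<close>: when they are distinct, the inversions change by \<open>length w\<close>
  modulo 2 and the positions by \<open>length w + 1\<close>, so the terms cancel.\<close>

lemma alt_sum_alt_ext_not_distinct:
  assumes "\<not> distinct v"
  shows "alt_sum (length v) (\<lambda>i. alt_ext \<phi> (del_nth i v) z) = 0"
proof -
  obtain u w r y where v: "v = u @ [y] @ w @ [y] @ r" using not_distinct_decomp[OF assms] by blast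
  define i where "i = length u"
  define j where "j = Suc (i + length w)"
  have di: "del_nth i v = u @ w @ y # r" by (simp add: del_nth_def v i_def)
  have dj: "del_nth j v = u @ y # w @ r" by (simp add: del_nth_def v i_def j_def)
  have ij: "i < length v" "j < length v" "i \<noteq> j" by (auto simp: v i_def j_def)
  have "alt_ext \<phi> (del_nth k v) z = 0" if k: "k < length v" "k \<noteq> i" "k \<noteq> j" for k
  proof -
    have "\<not> distinct (del_nth k v)"
    proof -
      obtain s t where st: "v = s @ v ! k # t" "del_nth k v = s @ t" "length s = k"
        using del_nth_split[OF k(1)] .
      have vi: "v ! i = y" "v ! j = y" "i < j"
        by (auto simp: v i_def j_def nth_append)
      \<comment> \<open>Deleting position \<open>k\<close> moves position \<open>l\<close> to
        \<open>l\<close> or \<open>l - 1\<close>, and this shift keeps \<open>i\<close> and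
        \<open>j\<close> apart.\<close>
      have e: "(s @ t) ! (if l < k then l else l - 1) = v ! l" "(if l < k then l else l - 1) < length (s @ t)"
        if l: "l < length v" "l \<noteq> k" for l
      proof -
        have lv: "length v = Suc (length (s @ t))" using st(1) by (metis length_append length_Cons add_Suc_right)
        show "(if l < k then l else l - 1) < length (s @ t)" using l lv st(3) by auto
        show "(s @ t) ! (if l < k then l else l - 1) = v ! l"
        proof (cases "l < k")
          case True
          then have "(s @ v ! k # t) ! l = s ! l" using st(3) by (simp add: nth_append)
          then show ?thesis using True st by (simp add: nth_append)
        next
          case False
          then obtain q where q: "l = Suc (k + q)" using l(2) less_iff_Suc_add by (metis linorder_neqE_nat)
          have "(s @ v ! k # t) ! l = t ! q" using st(3) q by (simp add: nth_append)
          then have "v ! l = t ! q" using st(1) by metis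
          then show ?thesis using st(3) q by (simp add: nth_append)
        qed
      qed
      define c where "c = (\<lambda>l. if l < k then l else l - 1)"
      have "c i \<noteq> c j" using vi(3) k by (auto simp: c_def)
      moreover have "(s @ t) ! c i = (s @ t) ! c j" "c i < length (s @ t)" "c j < length (s @ t)"
        using e[OF ij(1)] e[OF ij(2)] k(2,3) vi(1,2) unfolding c_def by simp_all
      ultimately show ?thesis unfolding st(2) using nth_eq_iff_index_eq by blast
    qed
    then show ?thesis by (simp add: alt_ext_def)
  qed
  then have "alt_sum (length v) (\<lambda>i. alt_ext \<phi> (del_nth i v) z)
      = (\<Sum>k\<in>{i, j}. sgn_pow k (alt_ext \<phi> (del_nth k v) z))"
    unfolding alt_sum_sg using ij by (intro sum.mono_neutral_right) auto
  also have "\<dots> = sgn_pow i (alt_ext \<phi> (u @ w @ y # r) z) + sgn_pow j (alt_ext \<phi> (u @ y # w @ r) z)"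
    using ij(3) by (simp add: di dj)
  also have "\<dots> = 0"
  proof (cases "distinct (u @ w @ y # r)")
    case False
    then have "\<not> distinct (u @ y # w @ r)" by auto
    then show ?thesis using False unfolding alt_ext_def by (simp only: if_False sgn_pow_zero add_0)
  next
    case True
    then have d2: "distinct (u @ y # w @ r)" and yw: "y \<notin> set w" by auto
    have "inversions (u @ w @ y # r) = inversions (u @ w @ r)
        + length (filter (\<lambda>b. y < b) (u @ w)) + length (filter (\<lambda>b. b < y) r)"
      using inversions_insert[of "u @ w" y r] by simp
    then have "odd (i + inversions (u @ w @ y # r) + (j + inversions (u @ y # w @ r)))"
      using length_filter_less_greater[OF yw] unfolding inversions_insert[of u y "w @ r"] j_def by auto
    moreover have "set (u @ y # w @ r) = set (u @ w @ y # r)" by auto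
    ultimately show ?thesis using True d2 unfolding alt_ext_def sgn_pow_sg by (auto simp: sgn_pow_def)
  qed
  finally show ?thesis .
qed

lemma fdom_eq_XX: "fdom x a = inter_dom x (set a)"
  by (auto simp: fdom_def inter_dom_def set_conv_nth)

lemma set_del_nth: "i < length u \<Longrightarrow> set (del_nth i u) \<subseteq> set u"
  unfolding del_nth_def by (auto dest: in_set_takeD in_set_dropD)

lemma coherent_alt_ext:
  assumes "1 \<le> n" "coh_sets n \<delta> UNIV x \<phi>"
  shows "coherent n \<delta> x (alt_ext \<phi>)"
  unfolding coherent_def
proof (intro conjI ballI alternating_alt_ext)
  fix v assume v: "v \<in> tuples (n + 1) \<delta>"
  then have len: "length v = n + 1" and sub: "set v \<subseteq> \<delta>" by (auto simp: tuples_def)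
  show "eq_fin_on (\<Inter>i<n + 1. fdom x (del_nth i v))
      (\<lambda>z. alt_sum (n + 1) (\<lambda>i. alt_ext \<phi> (del_nth i v) z)) (\<lambda>z. 0)"
  proof (cases "distinct v")
    case False
    then have "alt_sum (n + 1) (\<lambda>i. alt_ext \<phi> (del_nth i v) z) = 0" for z
      using alt_sum_alt_ext_not_distinct[OF False] len by simp
    then show ?thesis by (simp add: eq_fin_on_def)
  next
    case True
    have "alt_sum (n + 1) (\<lambda>i. alt_ext \<phi> (del_nth i v) z) = sgn_pow (inversions v) (coboundary \<phi> (set v) z)" for z
      using alt_sum_alt_ext_distinct[OF True] len by simp
    moreover have "set v \<in> fsets (Suc n) \<delta>" using True len sub by (simp add: fsets_def distinct_card)
    then have "eq_fin_on (inter_dom x (set v)) (coboundary \<phi> (set v)) (\<lambda>_. 0)" using assms(2) by (simp add: coh_sets_def)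
    moreover have "(\<Inter>i<n + 1. fdom x (del_nth i v)) \<subseteq> inter_dom x (set v)"
    proof
      fix z assume z: "z \<in> (\<Inter>i<n + 1. fdom x (del_nth i v))"
      have "z \<in> x y" if "y \<in> set v" for y
      proof -
        \<comment> \<open>Here n \<ge> 1 enters: some position carries an entry other than
          \<open>y\<close>, and the face omitting it still forces \<open>z\<close> into
          \<open>x y\<close>.\<close>
        obtain i where i: "i < n + 1" "v ! i \<noteq> y"
        proof (cases "v ! 0 = y")
          case True
          then show ?thesis using that[of 1] \<open>distinct v\<close> len assms(1)
            by (metis One_nat_def add_gr_0 less_add_same_cancel2 nth_eq_iff_index_eq zero_less_one
                order_less_le_trans zero_neq_one)
        qed (use that[of 0] in simp)
        have "i < length v" using i len by simp
        then obtain s t where "v = s @ v ! i # t" "del_nth i v = s @ t" by (rule del_nth_split)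
        then have "set v = insert (v ! i) (set (del_nth i v))"
          by (metis Un_insert_right list.simps(15) set_append)
        then have "y \<in> set (del_nth i v)" using \<open>y \<in> set v\<close> i(2) by auto
        then show ?thesis using z i(1) by (auto simp: fdom_eq_XX inter_dom_def)
      qed
      then show "z \<in> inter_dom x (set v)" by (simp add: inter_dom_def)
    qed
    ultimately have "{z \<in> \<Inter>i<n + 1. fdom x (del_nth i v).
        alt_sum (n + 1) (\<lambda>i. alt_ext \<phi> (del_nth i v) z) \<noteq> 0}
        \<subseteq> {z \<in> inter_dom x (set v). coboundary \<phi> (set v) z \<noteq> 0}"
      and "finite {z \<in> inter_dom x (set v). coboundary \<phi> (set v) z \<noteq> 0}"
      unfolding eq_fin_on_def by auto
    then show ?thesis unfolding eq_fin_on_def by (rule finite_subset)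
  qed
qed

text \<open>A trivialization over tuples is read off on increasing tuples. On these and on their
  faces all sorting signs are 1, so the alternating sum is exactly the coboundary on sets.\<close>

lemma not_trivial_alt_ext:
  assumes "1 \<le> n" "\<not> triv_sets UNIV n \<delta> UNIV x \<phi>"
  shows "\<not> trivial_family n \<delta> x (alt_ext \<phi>)"
proof
  assume t: "trivial_family n \<delta> x (alt_ext \<phi>)"
  \<comment> \<open>This puts both clauses of triviality into one form; for n = 1 the single
    function is regarded as a family indexed by the empty tuple.\<close>
  have "\<exists>\<psi>. \<forall>u\<in>tuples n \<delta>. eq_fin_on (fdom x u) (alt_ext \<phi> u) (\<lambda>z. alt_sum n (\<lambda>i. \<psi> (del_nth i u) z))"
  proof (cases "n = 1")
    case True
    then obtain \<psi> where \<psi>: "\<And>\<alpha>. \<alpha> \<in> \<delta> \<Longrightarrow> eq_fin_on (x \<alpha>) \<psi> (alt_ext \<phi> [\<alpha>])"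
      using t by (auto simp: trivial_family_def)
    show ?thesis
    proof (intro exI[of _ "\<lambda>_. \<psi>"] ballI)
      fix u assume "u \<in> tuples n \<delta>"
      then obtain \<alpha> where u: "u = [\<alpha>]" "\<alpha> \<in> \<delta>" using True by (auto simp: tuples_def length_Suc_conv)
      have "{z \<in> x \<alpha>. alt_ext \<phi> [\<alpha>] z \<noteq> \<psi> z} = {z \<in> x \<alpha>. \<psi> z \<noteq> alt_ext \<phi> [\<alpha>] z}" by auto
      then show "eq_fin_on (fdom x u) (alt_ext \<phi> u) (\<lambda>z. alt_sum n (\<lambda>i. \<psi> z))"
        using \<psi>[OF u(2)] True u by (simp add: eq_fin_on_def alt_sum_def fdom_eq_XX inter_dom_def)
    qed
  next
    case False
    then obtain \<psi> where \<psi>: "\<And>u. u \<in> tuples n \<delta> \<Longrightarrow>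
        eq_fin_on (fdom x u \<inter> (\<Inter>i<n. fdom x (del_nth i u))) (alt_ext \<phi> u)
          (\<lambda>z. alt_sum n (\<lambda>i. \<psi> (del_nth i u) z))"
      using t assms(1) unfolding trivial_family_def by blast
    show ?thesis
    proof (intro exI[of _ \<psi>] ballI)
      fix u assume u: "u \<in> tuples n \<delta>"
      have "fdom x u \<subseteq> fdom x (del_nth i u)" if "i < n" for i
        using set_del_nth[of i u] u that by (auto simp: fdom_eq_XX inter_dom_def tuples_def)
      then have "fdom x u \<inter> (\<Inter>i<n. fdom x (del_nth i u)) = fdom x u" by blast
      then show "eq_fin_on (fdom x u) (alt_ext \<phi> u) (\<lambda>z. alt_sum n (\<lambda>i. \<psi> (del_nth i u) z))"
        using \<psi>[OF u] by simp
    qed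
  qed
  then obtain \<psi> where \<psi>: "\<And>u. u \<in> tuples n \<delta> \<Longrightarrow>
      eq_fin_on (fdom x u) (alt_ext \<phi> u) (\<lambda>z. alt_sum n (\<lambda>i. \<psi> (del_nth i u) z))" by blast
  define \<psi>' where "\<psi>' = (\<lambda>a. \<psi> (sorted_list_of_set a))"
  have "triv_sets UNIV n \<delta> UNIV x \<phi>" unfolding triv_sets_def
  proof (intro exI[of _ \<psi>'] conjI allI ballI)
    fix a assume a: "a \<in> fsets n \<delta>"
    define u where "u = sorted_list_of_set a"
    have u: "set u = a" "sorted u" "distinct u" "length u = n"
      using a by (auto simp: u_def fsets_def)
    have del: "sorted (del_nth i u)" "distinct (del_nth i u)" if i: "i < n" for i
    proof -
      have "i < length u" using i u by simp
      then obtain s t where "u = s @ u ! i # t" "del_nth i u = s @ t" by (rule del_nth_split)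
      then show "sorted (del_nth i u)" "distinct (del_nth i u)"
        using u(2,3) by (metis sorted_append sorted_simps(2) list.set_intros(2))
          (metis distinct_append distinct.simps(2) \<open>u = s @ u ! i # t\<close> \<open>del_nth i u = s @ t\<close> u(3)
            Int_insert_right insert_disjoint(2) list.simps(15) Int_commute)
    qed
    have "alt_ext \<psi>' (del_nth i u) z = \<psi> (del_nth i u) z" if "i < n" for i z
      using del[OF that] by (simp add: alt_ext_def \<psi>'_def inversions_sorted
          sorted_list_of_set.idem_if_sorted_distinct)
    then have "alt_sum n (\<lambda>i. \<psi> (del_nth i u) z) = alt_sum (length u) (\<lambda>i. alt_ext \<psi>' (del_nth i u) z)" for z
      unfolding alt_sum_def u(4) by (intro sum.cong) auto
    then have "alt_sum n (\<lambda>i. \<psi> (del_nth i u) z) = coboundary \<psi>' a z" for z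
      using alt_sum_alt_ext_distinct[OF u(3)] u inversions_sorted[OF u(2)] by (simp add: sgn_pow_def)
    moreover have "alt_ext \<phi> u z = \<phi> a z" for z
      using u inversions_sorted[OF u(2)] by (simp add: alt_ext_def sgn_pow_def)
    moreover have "u \<in> tuples n \<delta>" using a u by (simp add: tuples_def fsets_def)
    ultimately show "eq_fin_on (UNIV \<inter> inter_dom x a) (\<phi> a) (coboundary \<psi>' a)"
      using \<psi>[of u] u(1) by (simp add: eq_fin_on_def fdom_eq_XX)
  qed simp
  then show False using assms(2) by simp
qed

theorem theorem3p6:
  fixes n :: nat
    and x :: "'o::wellorder \<Rightarrow> 's set"
  assumes "omegas_exist TYPE('o) n"
    and "1 \<le> n"
    and "ascending (omega n) x"
    and "\<exists>h :: 'h::ab_group_add. h \<noteq> 0"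
    and "|UNIV :: 'h set| \<le>o ctwo ^c |omega 1 :: 'o set|"
    and "\<forall>k<n. weak_diamond (omega (Suc k) :: 'o set) (S_cof k)"
  shows "(\<exists>\<phi> :: 'o list \<Rightarrow> 's \<Rightarrow> 'h.
            coherent n (omega n) x \<phi> \<and> \<not> trivial_family n (omega n) x \<phi>) \<and>
         (\<forall>e C. witnesses_ascending (omega n) x e C \<longrightarrow>
            (\<exists>\<phi> :: 'o list \<Rightarrow> 's \<Rightarrow> 'h.
               coherent n (omega n) x \<phi> \<and> \<not> trivial_family n (omega n) x \<phi> \<and>
               supported_on n (omega n) x e \<phi>))"
proof -
  have main: "\<exists>\<phi> :: 'o list \<Rightarrow> 's \<Rightarrow> 'h. coherent n (omega n) x \<phi> \<and>
      \<not> trivial_family n (omega n) x \<phi> \<and> supported_on n (omega n) x e \<phi>"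
    if w: "witnesses_ascending (omega n) x e C" for e C
  proof -
    obtain h :: 'h where h: "h \<noteq> 0" using assms(4) by blast
    obtain m where m: "n = Suc m" using assms(2) by (cases n) auto
    let ?E = "\<lambda>A. \<Union>w\<in>Fn_plus (A \<inter> omega n). e w"
    have "has_nontriv (Suc m) (UNIV :: 'h set) x UNIV ?E"
      using has_nontriv_UNIV[OF assms(1) h assms(5,6), of m x UNIV ?E C] ascending_op_if_witnesses[OF w] m by simp
    then obtain \<phi> :: "'o set \<Rightarrow> 's \<Rightarrow> 'h" where
      s: "\<And>a z. \<phi> a z \<noteq> 0 \<Longrightarrow> z \<in> ?E {..<Max a}" and
      \<phi>: "coh_sets n (omega n) UNIV x \<phi>" "\<not> triv_sets UNIV n (omega n) UNIV x \<phi>"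
      unfolding has_nontriv_def m by blast
    have "supported_on n (omega n) x e (alt_ext \<phi>)" unfolding supported_on_def
    proof (intro ballI subsetI)
      fix a z assume "z \<in> {z \<in> fdom x a. alt_ext \<phi> a z \<noteq> 0}"
      then have "\<phi> (set a) z \<noteq> 0" by (auto simp: alt_ext_def split: if_splits)
      then have "z \<in> ?E {..<Max (set a)}" by (rule s)
      then show "z \<in> (\<Union>w\<in>Fn_plus {..<Max (set a)}. e w)"
        using Fn_plus_mono[of "{..<Max (set a)} \<inter> omega n" "{..<Max (set a)}"] by blast
    qed
    then show ?thesis
      using coherent_alt_ext[OF assms(2) \<phi>(1)] not_trivial_alt_ext[OF assms(2) \<phi>(2)] by blast
  qed
  obtain e C where "witnesses_ascending (omega n) x e C" using assms(3) unfolding ascending_def by blast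
  then show ?thesis using main by blast
qed


end
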